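(* Let $0<\alpha<2$, let $T$ be an arbitrary index set, and let $(S_i,\mu_i)$, $i=1,2$, be measure spaces with positive $\sigma$-finite measures. Suppose an S$\alpha$S process $\{X_t\}_{t\in T}$ and an $\alpha$-Fréchet process $\{Y_t\}_{t\in T}$ are associated by $\{f_t^{(1)}\}_{t\in T}\subset L^\alpha_+(S_1,\mu_1)$. Then a family $\{f_t^{(2)}\}_{t\in T}\subset L^\alpha_+(S_2,\mu_2)$ is a spectral representation of $\{X_t\}_{t\in T}$ if and only if it is a spectral representation of $\{Y_t\}_{t\in T}$. Namely, $$\Big\{\int_{S_1}f_t^{(1)}\,dM_{\alpha,+}^{(1)}\Big\}_{t\in T}\stackrel{d}{=}\Big\{\int_{S_2}f_t^{(2)}\,dM_{\alpha,+}^{(2)}\Big\}_{t\in T}\iff\Big\{{}^{e}\!\!\int_{S_1}f_t^{(1)}\,dM_{\alpha,\vee}^{(1)}\Big\}_{t\in T}\stackrel{d}{=}\Big\{{}^{e}\!\!\int_{S_2}f_t^{(2)}\,dM_{\alpha,\vee}^{(2)}\Big\}_{t\in T},$$ where $M_{\alpha,+}^{(i)}$ and $M_{\alpha,\vee}^{(i)}$ are, respectively, an S$\alpha$S random measure and an $\alpha$-Fréchet random sup-measure on $S_i$ with control measure $\mu_i$, $i=1,2$.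
   Context: $L^\alpha_+(S,\mu)$ is the set of nonnegative functions in $L^\alpha(S,\mu)$; $\stackrel{d}{=}$ between processes means equality of finite-dimensional distributions. S$\alpha$S side: an S$\alpha$S (symmetric $\alpha$-stable) variable $X$ has $\mathbb E e^{-i\theta X}=e^{-\sigma^\alpha|\theta|^\alpha}$, $\theta\in\mathbb R$; an S$\alpha$S process is one all of whose finite real linear combinations are S$\alpha$S. For $\{f_t\}_{t\in T}\subset L^\alpha(S,\mu)$ and an S$\alpha$S random measure $M_{\alpha,+}$ on $S$ with control measure $\mu$, the process of stable integrals $\{\int_S f_t\,dM_{\alpha,+}\}_{t\in T}$ is the S$\alpha$S process $\{X_t\}$ whose finite-dimensional distributions are determined by $$\mathbb E\exp\Big\{-i\sum_{j=1}^n a_jX_{t_j}\Big\}=\exp\Big\{-\int_S\Big|\sum_{j=1}^n a_jf_{t_j}\Big|^\alpha d\mu\Big\},\quad a_j\in\mathbb R,\ t_j\in T,\ n\in\mathbb N.$$ $\alpha$-Fréchet side: an $\alpha$-Fréchet variable $Y$ has $\mathbb P(Y\le y)=e^{-\sigma^\alpha y^{-\alpha}}$, $y>0$; an $\alpha$-Fréchet process is one all of whose finite max-linear combinations $\bigvee_i a_iY_{t_i}$, $a_i\ge0$, are $\alpha$-Fréchet. For $\{f_t\}_{t\in T}\subset L^\alpha_+(S,\mu)$ and an $\alpha$-Fréchet random sup-measure $M_{\alpha,\vee}$ on $S$ with control measure $\mu$, the process of extremal integrals $\{{}^{e}\!\!\int_S f_t\,dM_{\alpha,\vee}\}_{t\in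 T}$ is the $\alpha$-Fréchet process $\{Y_t\}$ whose finite-dimensional distributions are $$\mathbb P(Y_{t_1}\le a_1,\dots,Y_{t_n}\le a_n)=\exp\Big\{-\int_S\Big(\bigvee_{j=1}^n f_{t_j}/a_j\Big)^\alpha d\mu\Big\},\quad a_j>0,\ t_j\in T,\ n\in\mathbb N.$$ A family $\{f_t\}$ is a spectral representation of an S$\alpha$S process $\{X_t\}$ (resp. an $\alpha$-Fréchet process $\{Y_t\}$) if $\{X_t\}\stackrel{d}{=}\{\int_S f_t\,dM_{\alpha,+}\}$ (resp. $\{Y_t\}\stackrel{d}{=}\{{}^{e}\!\!\int_S f_t\,dM_{\alpha,\vee}\}$). $\{X_t\}$ and $\{Y_t\}$ are associated by $\{f_t\}\subset L^\alpha_+(S,\mu)$ if $\{f_t\}$ is a spectral representation of both. *)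

theory Defs
  imports "HOL-Probability.Probability"
begin

definition L_space :: "real \<Rightarrow> 's measure \<Rightarrow> ('s \<Rightarrow> real) set" where
  "L_space \<alpha> M = {f \<in> borel_measurable M. integrable M (\<lambda>x. \<bar>f x\<bar> powr \<alpha>)}"

definition L_plus :: "real \<Rightarrow> 's measure \<Rightarrow> ('s \<Rightarrow> real) set" where
  "L_plus \<alpha> M = {f \<in> L_space \<alpha> M. AE x in M. 0 \<le> f x}"

definition fdd_eq ::
  "'i set \<Rightarrow> 'a measure \<Rightarrow> ('i \<Rightarrow> 'a \<Rightarrow> real) \<Rightarrow> 'b measure \<Rightarrow> ('i \<Rightarrow> 'b \<Rightarrow> real) \<Rightarrow> bool" where
  "fdd_eq T P X Q Y \<longleftrightarrow>
     (\<forall>J. finite J \<and> J \<subseteq> T \<longrightarrow>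
        distr P (\<Pi>\<^sub>M t\<in>J. borel) (\<lambda>\<omega>. \<lambda>t\<in>J. X t \<omega>) =
        distr Q (\<Pi>\<^sub>M t\<in>J. borel) (\<lambda>\<omega>. \<lambda>t\<in>J. Y t \<omega>))"


subsection \<open>Symmetric stable processes\<close>

text \<open>
  The scale \<open>\<sigma> = 0\<close> is allowed: the zero linear combination of a symmetric stable process
  is degenerate.
\<close>

definition SaS_variable :: "real \<Rightarrow> 'a measure \<Rightarrow> ('a \<Rightarrow> real) \<Rightarrow> bool" where
  "SaS_variable \<alpha> P X \<longleftrightarrow>
     X \<in> borel_measurable P \<and>
     (\<exists>\<sigma>\<ge>0. \<forall>\<theta>::real.
        (\<integral>\<omega>. exp (- (\<i> * complex_of_real (\<theta> * X \<omega>))) \<partial>P) =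
        complex_of_real (exp (- (\<sigma> powr \<alpha> * \<bar>\<theta>\<bar> powr \<alpha>))))"

definition SaS_process ::
  "real \<Rightarrow> 'i set \<Rightarrow> 'a measure \<Rightarrow> ('i \<Rightarrow> 'a \<Rightarrow> real) \<Rightarrow> bool" where
  "SaS_process \<alpha> T P X \<longleftrightarrow>
     prob_space P \<and>
     (\<forall>t\<in>T. X t \<in> borel_measurable P) \<and>
     (\<forall>n::nat. \<forall>t a. 0 < n \<and> (\<forall>j<n. t j \<in> T) \<longrightarrow>
        SaS_variable \<alpha> P (\<lambda>\<omega>. \<Sum>j<n. a j * X (t j) \<omega>))"

text \<open>
  The process of stable integrals of \<open>f\<close> with respect to a symmetric stable random measure
  with control measure \<open>M\<close> is specified through its finite-dimensional distributions;
  \<open>stable_integrals \<alpha> T M f P X\<close> states that \<open>X\<close>, defined on the probability space \<open>P\<close>, is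
  such a process.
\<close>

definition stable_integrals ::
  "real \<Rightarrow> 'i set \<Rightarrow> 's measure \<Rightarrow> ('i \<Rightarrow> 's \<Rightarrow> real) \<Rightarrow> 'a measure \<Rightarrow> ('i \<Rightarrow> 'a \<Rightarrow> real) \<Rightarrow> bool"
  where
  "stable_integrals \<alpha> T M f P X \<longleftrightarrow>
     (\<forall>t\<in>T. f t \<in> L_space \<alpha> M) \<and>
     SaS_process \<alpha> T P X \<and>
     (\<forall>n::nat. \<forall>t a. 0 < n \<and> (\<forall>j<n. t j \<in> T) \<longrightarrow>
        (\<integral>\<omega>. exp (- (\<i> * complex_of_real (\<Sum>j<n. a j * X (t j) \<omega>))) \<partial>P) =
        complex_of_real (exp (- (\<integral>x. \<bar>\<Sum>j<n. a j * f (t j) x\<bar> powr \<alpha> \<partial>M))))"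

text \<open>
  A process of integrals can always be realised on the path space \<open>'i \<Rightarrow> real\<close>, so it is no
  restriction to quantify over probability spaces of that type.
\<close>

definition SaS_spectral_rep ::
  "real \<Rightarrow> 'i set \<Rightarrow> 's measure \<Rightarrow> ('i \<Rightarrow> 's \<Rightarrow> real) \<Rightarrow> 'a measure \<Rightarrow> ('i \<Rightarrow> 'a \<Rightarrow> real) \<Rightarrow> bool"
  where
  "SaS_spectral_rep \<alpha> T M f P X \<longleftrightarrow>
     SaS_process \<alpha> T P X \<and>
     (\<exists>(R :: ('i \<Rightarrow> real) measure) Z. stable_integrals \<alpha> T M f R Z \<and> fdd_eq T P X R Z)"


subsection \<open>Frechet processes\<close>

text \<open>
  The scale \<open>\<sigma> = 0\<close> is allowed and stands for the variable that vanishes almost surely. Since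
  the formula for the distribution function concerns only \<open>y > 0\<close>, almost sure nonnegativity
  has to be required; it is automatic when \<open>\<sigma> > 0\<close>.
\<close>

definition Frechet_variable :: "real \<Rightarrow> 'a measure \<Rightarrow> ('a \<Rightarrow> real) \<Rightarrow> bool" where
  "Frechet_variable \<alpha> P Y \<longleftrightarrow>
     Y \<in> borel_measurable P \<and>
     (AE \<omega> in P. 0 \<le> Y \<omega>) \<and>
     (\<exists>\<sigma>\<ge>0. \<forall>y>0. \<P>(\<omega> in P. Y \<omega> \<le> y) = exp (- (\<sigma> powr \<alpha> * y powr (- \<alpha>))))"

definition Frechet_process ::
  "real \<Rightarrow> 'i set \<Rightarrow> 'a measure \<Rightarrow> ('i \<Rightarrow> 'a \<Rightarrow> real) \<Rightarrow> bool" where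
  "Frechet_process \<alpha> T P Y \<longleftrightarrow>
     prob_space P \<and>
     (\<forall>t\<in>T. Y t \<in> borel_measurable P) \<and>
     (\<forall>n::nat. \<forall>t a. 0 < n \<and> (\<forall>j<n. t j \<in> T \<and> 0 \<le> a j) \<longrightarrow>
        Frechet_variable \<alpha> P (\<lambda>\<omega>. MAX j\<in>{..<n}. a j * Y (t j) \<omega>))"

definition extremal_integrals ::
  "real \<Rightarrow> 'i set \<Rightarrow> 's measure \<Rightarrow> ('i \<Rightarrow> 's \<Rightarrow> real) \<Rightarrow> 'a measure \<Rightarrow> ('i \<Rightarrow> 'a \<Rightarrow> real) \<Rightarrow> bool"
  where
  "extremal_integrals \<alpha> T M f P Y \<longleftrightarrow>
     (\<forall>t\<in>T. f t \<in> L_plus \<alpha> M) \<and>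
     Frechet_process \<alpha> T P Y \<and>
     (\<forall>n::nat. \<forall>t a. 0 < n \<and> (\<forall>j<n. t j \<in> T \<and> 0 < a j) \<longrightarrow>
        \<P>(\<omega> in P. \<forall>j<n. Y (t j) \<omega> \<le> a j) =
        exp (- (\<integral>x. (MAX j\<in>{..<n}. f (t j) x / a j) powr \<alpha> \<partial>M)))"

definition Frechet_spectral_rep ::
  "real \<Rightarrow> 'i set \<Rightarrow> 's measure \<Rightarrow> ('i \<Rightarrow> 's \<Rightarrow> real) \<Rightarrow> 'a measure \<Rightarrow> ('i \<Rightarrow> 'a \<Rightarrow> real) \<Rightarrow> bool"
  where
  "Frechet_spectral_rep \<alpha> T M f P Y \<longleftrightarrow>
     Frechet_process \<alpha> T P Y \<and>
     (\<exists>(R :: ('i \<Rightarrow> real) measure) Z. extremal_integrals \<alpha> T M f R Z \<and> fdd_eq T P Y R Z)"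

definition associated_by ::
  "real \<Rightarrow> 'i set \<Rightarrow> 'a measure \<Rightarrow> ('i \<Rightarrow> 'a \<Rightarrow> real) \<Rightarrow> 'b measure \<Rightarrow> ('i \<Rightarrow> 'b \<Rightarrow> real) \<Rightarrow>
   's measure \<Rightarrow> ('i \<Rightarrow> 's \<Rightarrow> real) \<Rightarrow> bool" where
  "associated_by \<alpha> T P X Q Y M f \<longleftrightarrow>
     (\<forall>t\<in>T. f t \<in> L_plus \<alpha> M) \<and>
     SaS_spectral_rep \<alpha> T M f P X \<and> Frechet_spectral_rep \<alpha> T M f Q Y"

end

theory Submission
  imports Defs
begin

text \<open>
  Fix finitely many indices and write \<open>f = (f\<^sub>1, \<dots>, f\<^sub>n)\<close> for the corresponding spectral functions on
  \<open>(S, \<mu>)\<close>. Let \<open>\<Lambda>\<close> be the image of \<open>\<mu>(ds) \<bar>r\<bar>\<^sup>-\<^sup>\<alpha>\<^sup>-\<^sup>1 dr\<close> under \<open>(s, r) \<mapsto> r f(s)\<close>. This is the Levy measure of the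
  stable vector with spectral functions \<open>f\<close>, up to a constant, and its positive part is the exponent
  measure of the Frechet vector. Rescaling \<open>r\<close> gives
  \<open>\<integral> (1 - cos \<langle>a, x\<rangle>) d\<Lambda> = C \<integral> \<bar>\<Sum> a\<^sub>j f\<^sub>j\<bar>\<^sup>\<alpha> d\<mu>\<close> and, for non-negative \<open>f\<close> and positive \<open>a\<close>,
  \<open>\<Lambda> {x. \<exists>j. x\<^sub>j > a\<^sub>j} = K \<integral> (max f\<^sub>j / a\<^sub>j)\<^sup>\<alpha> d\<mu>\<close>, where \<open>C\<close> and \<open>K\<close> depend on \<open>\<alpha>\<close> alone and lie
  strictly between \<open>0\<close> and \<open>\<infinity>\<close> because \<open>0 < \<alpha> < 2\<close>. The stable law is equivalent to the first family of
  numbers and the Frechet law to the second, so it suffices that each family determines the part of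
  \<open>\<Lambda>\<close> from which the other is computed (\<open>sum_norms_eq_iff_max_norms_eq\<close>).

  From sums to maxima: multiply \<open>\<Lambda>\<close> by a bounded weight \<open>W\<close>, a sum of functions \<open>1 - cos (s x\<^sub>j)\<close>, which
  vanishes only at the origin. Then \<open>W \<Lambda>\<close> is a finite symmetric measure, and its cosine transform is a
  combination of the known integrals of \<open>1 - cos \<langle>b, x\<rangle>\<close>. Uniqueness of characteristic
  functions determines \<open>W \<Lambda>\<close>, and division by \<open>W\<close> determines \<open>\<Lambda>\<close> off the origin
  (\<open>levy_measure_eq_off_origin\<close>). Working with the Levy measure rather than with moments on a
  simplex treats all \<open>\<alpha>\<close> alike, including \<open>\<alpha> = 1\<close>.

  From maxima to sums: the restriction of \<open>\<Lambda>\<close> to \<open>{x. \<exists>j. x\<^sub>j > \<epsilon>}\<close> is a finite measure on the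
  non-negative orthant whose distribution function is a difference of known exceedance masses. Letting
  \<open>\<epsilon>\<close> tend to \<open>0\<close> determines \<open>\<Lambda>\<close> on \<open>{x. \<exists>j. x\<^sub>j > 0}\<close> (\<open>measure_eq_on_positive_part\<close>), and
  non-negativity of \<open>f\<close> makes that half of \<open>\<Lambda>\<close> enough to recover \<open>\<integral> \<bar>\<Sum> a\<^sub>j f\<^sub>j\<bar>\<^sup>\<alpha> d\<mu>\<close>.
\<close>

section \<open>Finite measures on finite products of real lines\<close>

text \<open>
  Uniqueness in several dimensions is reduced to one dimension by replacing the factors
  \<open>g\<^sub>j (x\<^sub>j)\<close> by indicators one coordinate at a time: with all other factors collected in a weight
  \<open>w\<close>, the law of the coordinate \<open>x\<^sub>k\<close> under \<open>w M\<close> is a finite measure on the line to which the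
  one-dimensional hypothesis applies. Test functions are required to be non-negative so that \<open>w M\<close> is
  a measure, and bounded so that it is finite. The lemma serves both for distribution functions
  and for characteristic functions.
\<close>

lemma finite_measure_eqI_products:
  fixes M N :: "('k \<Rightarrow> real) measure" and G :: "(real \<Rightarrow> ennreal) set"
  assumes J: "finite J"
    and sM: "sets M = sets (PiM J (\<lambda>_. borel))" and sN: "sets N = sets (PiM J (\<lambda>_. borel))"
    and fM: "finite_measure M" and fN: "finite_measure N"
    and G: "\<And>g. g \<in> G \<Longrightarrow> g \<in> borel_measurable borel" "\<And>g x. g \<in> G \<Longrightarrow> g x \<le> 1"
    and one: "\<And>m n :: real measure. sets m = sets borel \<Longrightarrow> sets n = sets borel \<Longrightarrow>
          finite_measure m \<Longrightarrow> finite_measure n \<Longrightarrow>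
          (\<And>g. g \<in> G \<Longrightarrow> (\<integral>\<^sup>+x. g x \<partial>m) = (\<integral>\<^sup>+x. g x \<partial>n)) \<Longrightarrow> m = n"
    and eq: "\<And>g. (\<And>j. j \<in> J \<Longrightarrow> g j \<in> G) \<Longrightarrow>
          (\<integral>\<^sup>+x. (\<Prod>j\<in>J. g j (x j)) \<partial>M) = (\<integral>\<^sup>+x. (\<Prod>j\<in>J. g j (x j)) \<partial>N)"
  shows "M = N"
proof -
  interpret M: finite_measure M by fact
  interpret N: finite_measure N by fact
  have spM: "space M = (\<Pi>\<^sub>E j\<in>J. UNIV)" using sets_eq_imp_space_eq[OF sM] by (simp add: space_PiM)
  have spN: "space N = (\<Pi>\<^sub>E j\<in>J. UNIV)" using sets_eq_imp_space_eq[OF sN] by (simp add: space_PiM)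
  have comp: "(\<lambda>x. h (x j)) \<in> borel_measurable (PiM J (\<lambda>_. borel))"
    if "j \<in> J" "h \<in> borel_measurable borel" for j and h :: "real \<Rightarrow> ennreal"
    using measurable_compose[OF measurable_component_singleton[OF that(1)] that(2)] .
  \<comment> \<open>the factors with index in \<open>K\<close> have already been replaced by indicators\<close>
  define h where "h K B g = (\<lambda>j. if j \<in> K then indicator (B j) else g j)"
    for K :: "'k set" and B :: "'k \<Rightarrow> real set" and g :: "'k \<Rightarrow> real \<Rightarrow> ennreal"
  have rect: "(\<integral>\<^sup>+x. (\<Prod>j\<in>J. h K B g j (x j)) \<partial>M) = (\<integral>\<^sup>+x. (\<Prod>j\<in>J. h K B g j (x j)) \<partial>N)"
    if "K \<subseteq> J" "\<And>j. j \<in> K \<Longrightarrow> B j \<in> sets borel" "\<And>j. j \<in> J - K \<Longrightarrow> g j \<in> G" for K B g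
  proof -
    have "finite K" using that(1) J by (rule finite_subset)
    then show ?thesis using that
    proof (induction K arbitrary: g)
      case empty
      then show ?case using eq[of g] by (simp add: h_def)
    next
      case (insert k K)
      have kJ: "k \<in> J" using insert by auto
      define w where "w x = (\<Prod>j\<in>J-{k}. h K B g j (x j))" for x :: "'k \<Rightarrow> real"
      have hm: "h K B g j \<in> borel_measurable borel" if "j \<in> J - {k}" for j
        using that insert.prems G(1) by (auto simp: h_def)
      have w: "w \<in> borel_measurable (PiM J (\<lambda>_. borel))"
        unfolding w_def by (intro borel_measurable_prod_ennreal comp hm) auto
      have w1: "w x \<le> 1" for x
        unfolding w_def
        by (rule prod_le_1) (use insert.prems G(2) in \<open>auto simp: h_def indicator_def\<close>)
      have xk: "(\<lambda>x. x k) \<in> measurable (PiM J (\<lambda>_. borel)) borel"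
        by (rule measurable_component_singleton[OF kJ])
      have val: "(\<integral>\<^sup>+x. u x \<partial>distr (density L w) borel (\<lambda>x. x k)) = (\<integral>\<^sup>+x. w x * u (x k) \<partial>L)"
        if "sets L = sets (PiM J (\<lambda>_. borel))" "u \<in> borel_measurable borel" for L u
      proof -
        have "w \<in> borel_measurable L" "(\<lambda>x. x k) \<in> measurable (density L w) borel"
          using that w xk by (auto cong: measurable_cong_sets)
        moreover have "(\<lambda>x. u (x k)) \<in> borel_measurable L"
          using comp[OF kJ that(2)] that(1) by (auto cong: measurable_cong_sets)
        ultimately show ?thesis using that by (simp add: nn_integral_distr nn_integral_density)
      qed
      have fin: "finite_measure (distr (density L w) borel (\<lambda>x. x k))"
        if "sets L = sets (PiM J (\<lambda>_. borel))" "finite_measure L" for L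
      proof (rule finite_measureI)
        have "emeasure (distr (density L w) borel (\<lambda>x. x k)) UNIV = (\<integral>\<^sup>+x. w x * 1 \<partial>L)"
          using val[OF that(1), of "\<lambda>_. 1"] by simp
        also have "\<dots> \<le> (\<integral>\<^sup>+x. 1 \<partial>L)" using w1 by (intro nn_integral_mono) auto
        also have "\<dots> < \<top>" using finite_measure.emeasure_finite[OF that(2)] by (simp add: less_top)
        finally show "emeasure (distr (density L w) borel (\<lambda>x. x k))
            (space (distr (density L w) borel (\<lambda>x. x k))) \<noteq> \<infinity>" by simp
      qed
      have split: "(\<Prod>j\<in>J. h K' B g' j (x j)) = w x * h K' B g' k (x k)"
        if "\<And>j. j \<in> J - {k} \<Longrightarrow> h K' B g' j = h K B g j" for K' g' and x :: "'k \<Rightarrow> real"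
        using that by (simp add: w_def prod.remove[OF J kJ] mult.commute)
      have "distr (density M w) borel (\<lambda>x. x k) = distr (density N w) borel (\<lambda>x. x k)"
      proof (rule one)
        fix u assume u: "u \<in> G"
        have s: "(\<Prod>j\<in>J. h K B (g(k:=u)) j (x j)) = w x * u (x k)" for x
          using split[of K "g(k:=u)" x] insert.hyps by (simp add: h_def)
        have "(\<integral>\<^sup>+x. w x * u (x k) \<partial>M) = (\<integral>\<^sup>+x. w x * u (x k) \<partial>N)"
          using insert.IH[of "g(k:=u)"] insert.prems u unfolding s by auto
        then show "(\<integral>\<^sup>+x. u x \<partial>distr (density M w) borel (\<lambda>x. x k))
            = (\<integral>\<^sup>+x. u x \<partial>distr (density N w) borel (\<lambda>x. x k))"
          using val[OF sM] val[OF sN] G(1)[OF u] by simp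
      qed (use fin sM sN fM fN in auto)
      then have "(\<integral>\<^sup>+x. indicator (B k) x \<partial>distr (density M w) borel (\<lambda>x. x k))
            = (\<integral>\<^sup>+x. indicator (B k) x \<partial>distr (density N w) borel (\<lambda>x. x k))" by simp
      then have "(\<integral>\<^sup>+x. w x * indicator (B k) (x k) \<partial>M) = (\<integral>\<^sup>+x. w x * indicator (B k) (x k) \<partial>N)"
        using insert.prems(2)[of k] by (simp only: val[OF sM] val[OF sN] borel_measurable_indicator insertI1)
      moreover have "(\<Prod>j\<in>J. h (insert k K) B g j (x j)) = w x * indicator (B k) (x k)" for x
        using split[of "insert k K" g x] by (simp add: h_def)
      ultimately show ?case by simp
    qed
  qed
  have ind: "(\<Prod>j\<in>J. indicator (B j) (x j)) = (indicator (Pi\<^sub>E J B) x :: ennreal)"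
    if "x \<in> (\<Pi>\<^sub>E j\<in>J. UNIV)" for x and B :: "'k \<Rightarrow> real set"
  proof (cases "x \<in> Pi\<^sub>E J B")
    case True
    then show ?thesis by (auto intro!: prod.neutral simp: PiE_iff)
  next
    case False
    moreover have "x \<in> extensional J" using that by (simp add: PiE_iff)
    ultimately obtain j where "j \<in> J" "x j \<notin> B j" by (auto simp: PiE_iff)
    then have "(\<Prod>j\<in>J. indicator (B j) (x j) :: ennreal) = 0" using J by (intro prod_zero) (auto simp: indicator_def)
    with False show ?thesis by simp
  qed
  have em: "emeasure M (Pi\<^sub>E J B) = emeasure N (Pi\<^sub>E J B)" if B: "\<And>j. j \<in> J \<Longrightarrow> B j \<in> sets borel" for B
  proof -
    have BP: "Pi\<^sub>E J B \<in> sets (PiM J (\<lambda>_. borel))" using J B by (intro sets_PiM_I_finite) auto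
    have "emeasure M (Pi\<^sub>E J B) = (\<integral>\<^sup>+x. indicator (Pi\<^sub>E J B) x \<partial>M)" using BP sM by simp
    also have "\<dots> = (\<integral>\<^sup>+x. (\<Prod>j\<in>J. h J B undefined j (x j)) \<partial>M)"
      by (intro nn_integral_cong) (simp add: h_def ind spM)
    also have "\<dots> = (\<integral>\<^sup>+x. (\<Prod>j\<in>J. h J B undefined j (x j)) \<partial>N)"
      using rect[of J B] B by simp
    also have "\<dots> = (\<integral>\<^sup>+x. indicator (Pi\<^sub>E J B) x \<partial>N)"
      by (intro nn_integral_cong) (simp add: h_def ind spN)
    also have "\<dots> = emeasure N (Pi\<^sub>E J B)" using BP sN by simp
    finally show ?thesis .
  qed
  show "M = N"
  proof (rule measure_eqI_PiM_finite[where A="\<lambda>_. \<Pi>\<^sub>E j\<in>J. UNIV" and M="\<lambda>_. borel" and I=J])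
    show "range (\<lambda>_::nat. \<Pi>\<^sub>E j\<in>J. UNIV) \<subseteq> prod_algebra J (\<lambda>_. borel :: real measure)"
      using J by (auto intro!: prod_algebraI_finite)
    show "(\<Union>i::nat. \<Pi>\<^sub>E j\<in>J. UNIV) = space (PiM J (\<lambda>_. borel :: real measure))"
      by (simp add: space_PiM)
  qed (use J sM sN em in auto)
qed

text \<open>
  Levels \<open>a\<^sub>j \<noteq> 0\<close> are enough on the line because distribution functions are right continuous, which
  recovers the value at \<open>0\<close>. If some level is negative, both sides vanish by non-negativity, so
  only strictly positive levels have to be compared.
\<close>

lemma finite_measure_eqI_orthants:
  fixes M N :: "('k \<Rightarrow> real) measure"
  assumes J: "finite J"
    and sM: "sets M = sets (PiM J (\<lambda>_. borel))" and sN: "sets N = sets (PiM J (\<lambda>_. borel))"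
    and fM: "finite_measure M" and fN: "finite_measure N"
    and nM: "\<And>j. j \<in> J \<Longrightarrow> AE x in M. 0 \<le> x j" and nN: "\<And>j. j \<in> J \<Longrightarrow> AE x in N. 0 \<le> x j"
    and eq: "\<And>a. (\<And>j. j \<in> J \<Longrightarrow> 0 < a j) \<Longrightarrow>
       emeasure M {x \<in> space M. \<forall>j\<in>J. x j \<le> a j} = emeasure N {x \<in> space N. \<forall>j\<in>J. x j \<le> a j}"
  shows "M = N"
proof (rule finite_measure_eqI_products[where G="(\<lambda>a. indicator {..a}) ` (- {0})", OF J sM sN fM fN])
  fix m n :: "real measure"
  assume s: "sets m = sets borel" "sets n = sets borel" and f: "finite_measure m" "finite_measure n"
    and e: "\<And>g. g \<in> (\<lambda>a. indicator {..a}) ` (- {0}) \<Longrightarrow> (\<integral>\<^sup>+x. g x \<partial>m) = (\<integral>\<^sup>+x. g x \<partial>n)"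
  interpret m: finite_borel_measure m using f s by (simp add: finite_borel_measure_def finite_borel_measure_axioms_def)
  interpret n: finite_borel_measure n using f s by (simp add: finite_borel_measure_def finite_borel_measure_axioms_def)
  have ne: "cdf m a = cdf n a" if "a \<noteq> 0" for a
    using e[of "indicator {..a}"] that s by (simp add: cdf_def measure_def)
  have "(cdf m \<longlongrightarrow> cdf m 0) (at_right 0)" "(cdf n \<longlongrightarrow> cdf n 0) (at_right 0)"
    using m.cdf_is_right_cont n.cdf_is_right_cont by (auto simp: continuous_within)
  moreover have "eventually (\<lambda>a. cdf n a = cdf m a) (at_right 0)"
    using eventually_at_right_less[of "0::real"] by eventually_elim (simp add: ne)
  ultimately have "cdf m 0 = cdf n 0"
    using tendsto_cong[of "cdf n" "cdf m" "at_right 0"] tendsto_unique[of "at_right (0::real)"] by force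
  then have "cdf m = cdf n" using ne by (intro ext) (metis)
  then show "m = n" by (intro cdf_unique') unfold_locales
next
  fix g :: "'k \<Rightarrow> real \<Rightarrow> ennreal"
  assume g: "\<And>j. j \<in> J \<Longrightarrow> g j \<in> (\<lambda>a. indicator {..a}) ` (- {0})"
  then obtain a where a: "\<And>j. j \<in> J \<Longrightarrow> g j = indicator {..a j} \<and> a j \<noteq> 0"
    by (auto simp: image_iff Bex_def) metis
  have prod: "(\<Prod>j\<in>J. g j (x j)) = indicator {x. \<forall>j\<in>J. x j \<le> a j} x" for x
  proof (cases "\<forall>j\<in>J. x j \<le> a j")
    case True
    then show ?thesis using a by (auto intro!: prod.neutral)
  next
    case False
    then obtain j where j: "j \<in> J" "\<not> x j \<le> a j" by auto
    then have "g j (x j) = 0" using a[OF j(1)] by simp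
    then have "(\<Prod>j\<in>J. g j (x j)) = 0" using J j(1) by (intro prod_zero) auto
    with False show ?thesis by simp
  qed
  have int: "(\<integral>\<^sup>+x. (\<Prod>j\<in>J. g j (x j)) \<partial>L) = emeasure L {x \<in> space L. \<forall>j\<in>J. x j \<le> a j}"
    if s: "sets L = sets (PiM J (\<lambda>_. borel))" for L
  proof -
    have "{x \<in> space (PiM J (\<lambda>_. borel)). \<forall>j\<in>J. x j \<le> a j} \<in> sets (PiM J (\<lambda>_. borel))"
      using J by measurable
    then have S: "{x \<in> space L. \<forall>j\<in>J. x j \<le> a j} \<in> sets L"
      using s sets_eq_imp_space_eq[OF s] by simp
    have "(\<integral>\<^sup>+x. (\<Prod>j\<in>J. g j (x j)) \<partial>L) = (\<integral>\<^sup>+x. indicator {x \<in> space L. \<forall>j\<in>J. x j \<le> a j} x \<partial>L)"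
      unfolding prod by (intro nn_integral_cong) (auto simp: indicator_def)
    then show ?thesis using S by simp
  qed
  show "(\<integral>\<^sup>+x. (\<Prod>j\<in>J. g j (x j)) \<partial>M) = (\<integral>\<^sup>+x. (\<Prod>j\<in>J. g j (x j)) \<partial>N)"
  proof (cases "\<forall>j\<in>J. 0 < a j")
    case True
    then show ?thesis using eq[of a] int[OF sM] int[OF sN] by simp
  next
    case False
    then obtain k where k: "k \<in> J" "a k < 0" using a by force
    have z: "(\<integral>\<^sup>+x. (\<Prod>j\<in>J. g j (x j)) \<partial>L) = 0" if "AE x in L. 0 \<le> x k" for L
    proof -
      have "(\<integral>\<^sup>+x. (\<Prod>j\<in>J. g j (x j)) \<partial>L) = (\<integral>\<^sup>+x. 0 \<partial>L)"
        using that by (intro nn_integral_cong_AE, eventually_elim) (use k in \<open>force simp: prod indicator_def\<close>)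
      then show ?thesis by simp
    qed
    show ?thesis using z[OF nM[OF k(1)]] z[OF nN[OF k(1)]] by simp
  qed
qed (auto simp: indicator_def of_bool_def split: if_splits)

text \<open>
  Levy's uniqueness theorem, carried over from probability measures to finite measures by
  normalising. The phases \<open>c = 0\<close> and \<open>c = - \<pi> / 2\<close> give the real and imaginary parts of the
  characteristic function.
\<close>

lemma finite_borel_measure_eqI_cos:
  fixes m n :: "real measure"
  assumes s: "sets m = sets borel" "sets n = sets borel" and f: "finite_measure m" "finite_measure n"
    and e: "\<And>a c. (\<integral>x. cos (a * x + c) \<partial>m) = (\<integral>x. cos (a * x + c) \<partial>n)"
  shows "m = n"
proof -
  interpret m: finite_measure m by fact
  interpret n: finite_measure n by fact
  have sp: "space m = UNIV" "space n = UNIV"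
    using s[THEN sets_eq_imp_space_eq] by simp_all
  have bm: "borel_measurable m = borel_measurable borel" "borel_measurable n = borel_measurable borel"
    using s by (auto intro: measurable_cong_sets)
  define c where "c = measure m UNIV"
  have c: "measure n UNIV = c" using e[of 0 0] sp by (simp add: c_def)
  have em: "emeasure m UNIV = ennreal c" "emeasure n UNIV = ennreal c"
    using m.emeasure_eq_measure n.emeasure_eq_measure c by (auto simp: c_def)
  show ?thesis
  proof (cases "c = 0")
    case True
    show ?thesis
    proof (rule measure_eqI)
      fix A assume "A \<in> sets m"
      have "emeasure m A \<le> 0" "emeasure n A \<le> 0"
        using emeasure_space[of m A] emeasure_space[of n A] em True sp by auto
      then show "emeasure m A = emeasure n A" by simp
    qed (use s in simp)
  next
    case False
    then have c0: "c > 0" by (simp add: c_def order.not_eq_order_implies_strict)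
    have rd: "real_distribution (density l (\<lambda>_. ennreal (1/c)))"
      if "sets l = sets borel" "space l = UNIV" "emeasure l UNIV = ennreal c" for l
    proof -
      have "emeasure (density l (\<lambda>_. ennreal (1/c))) UNIV = ennreal (1/c) * ennreal c"
        using that by (subst emeasure_density) auto
      also have "\<dots> = 1" using c0 by (simp add: ennreal_mult[symmetric])
      finally show ?thesis
        using that by (auto intro!: prob_spaceI simp: real_distribution_def real_distribution_axioms_def)
    qed
    have ch: "char (density l (\<lambda>_. ennreal (1/c))) t
        = (1/c) *\<^sub>R (Complex (\<integral>x. cos (t * x + 0) \<partial>l) (\<integral>x. cos (t * x + (- pi/2)) \<partial>l))"
      if "sets l = sets borel" "finite_measure l" for l t
    proof -
      interpret l: finite_measure l by fact
      have bl: "borel_measurable l = borel_measurable borel"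
           "borel_measurable l = (borel_measurable borel :: (real \<Rightarrow> complex) set)"
        using that by (auto intro: measurable_cong_sets)
      have I: "integrable l (\<lambda>x. iexp (t * x))"
        by (rule l.integrable_const_bound[where B=1]) (auto simp: bl)
      have "char (density l (\<lambda>_. ennreal (1/c))) t = (\<integral>x. (1/c) *\<^sub>R iexp (t * x) \<partial>l)"
        unfolding char_def by (subst integral_density) (use c0 in \<open>auto simp: bl\<close>)
      also have "\<dots> = (1/c) *\<^sub>R (\<integral>x. iexp (t * x) \<partial>l)" by simp
      also have "(\<integral>x. iexp (t * x) \<partial>l) = Complex (\<integral>x. cos (t * x + 0) \<partial>l) (\<integral>x. cos (t * x + (- pi/2)) \<partial>l)"
      proof (rule complex_eqI)
        show "Re (\<integral>x. iexp (t * x) \<partial>l) = Re (Complex (\<integral>x. cos (t * x + 0) \<partial>l) (\<integral>x. cos (t * x + (- pi/2)) \<partial>l))"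
          using integral_Re[OF I] by (simp add: Re_exp)
        show "Im (\<integral>x. iexp (t * x) \<partial>l) = Im (Complex (\<integral>x. cos (t * x + 0) \<partial>l) (\<integral>x. cos (t * x + (- pi/2)) \<partial>l))"
          using integral_Im[OF I] by (simp add: Im_exp cos_add cos_diff)
      qed
      finally show ?thesis .
    qed
    have "char (density m (\<lambda>_. ennreal (1/c))) = char (density n (\<lambda>_. ennreal (1/c)))"
      by (intro ext) (simp only: ch[OF s(1) f(1)] ch[OF s(2) f(2)] e)
    then have d: "density m (\<lambda>_. ennreal (1/c)) = density n (\<lambda>_. ennreal (1/c))"
      using rd s sp em by (intro Levy_uniqueness) auto
    have rescale: "emeasure l A = ennreal c * emeasure (density l (\<lambda>_. ennreal (1/c))) A" if "A \<in> sets l" for l A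
    proof -
      have "ennreal c * emeasure (density l (\<lambda>_. ennreal (1/c))) A = ennreal c * (ennreal (1/c) * emeasure l A)"
        using that by (subst emeasure_density) (auto simp: nn_integral_cmult_indicator)
      also have "\<dots> = emeasure l A"
        using c0 by (simp add: ennreal_mult[symmetric] mult.assoc[symmetric])
      finally show ?thesis by simp
    qed
    show ?thesis
    proof (rule measure_eqI)
      fix A assume "A \<in> sets m"
      then show "emeasure m A = emeasure n A"
        using rescale[of A m] rescale[of A n] s d by simp
    qed (use s in simp)
  qed
qed

text \<open>
  The test functions \<open>(1 + cos (a x + c)) / 2\<close> take values in \<open>[0, 1]\<close>, and repeated use of the
  product-to-sum formula turns a product of them over the coordinates into a combination of functions
  \<open>cos (\<langle>b, x\<rangle> + d)\<close>. Carrying one extra factor \<open>cos (\<langle>b, x\<rangle> + d)\<close> through the induction makes this work.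
\<close>

lemma finite_measure_eqI_cos:
  fixes M N :: "('k \<Rightarrow> real) measure"
  assumes J: "finite J"
    and sM: "sets M = sets (PiM J (\<lambda>_. borel))" and sN: "sets N = sets (PiM J (\<lambda>_. borel))"
    and fM: "finite_measure M" and fN: "finite_measure N"
    and eq: "\<And>a c. (\<integral>x. cos ((\<Sum>j\<in>J. a j * x j) + c) \<partial>M) = (\<integral>x. cos ((\<Sum>j\<in>J. a j * x j) + c) \<partial>N)"
  shows "M = N"
proof -
  define G where "G = (\<lambda>(a,c) x. ennreal ((1 + cos (a * x + c)) / 2)) ` (UNIV :: (real\<times>real) set)"
  have cb1: "0 \<le> (1 + cos y) / 2" for y :: real
    using add_left_mono[OF cos_ge_minus_one[of y], of 1] by simp
  have cb2: "(1 + cos y) / 2 \<le> 1" for y :: real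
    using add_left_mono[OF cos_le_one[of y], of 1] by simp
  note cb = cb1 cb2
  have trig: "(1 + cos u) / 2 * cos v = cos v / 2 + cos (v + u) / 4 + cos (v - u) / 4" for u v :: real
    by (simp add: cos_add cos_diff field_simps)
  show ?thesis
  proof (rule finite_measure_eqI_products[where G=G, OF J sM sN fM fN])
    fix g assume g: "g \<in> G"
    then show "g \<in> borel_measurable borel" by (auto simp: G_def)
    show "g x \<le> 1" for x using g cb by (auto simp: G_def)
  next
    fix m n :: "real measure"
    assume s: "sets m = sets borel" "sets n = sets borel" and f: "finite_measure m" "finite_measure n"
      and e: "\<And>g. g \<in> G \<Longrightarrow> (\<integral>\<^sup>+x. g x \<partial>m) = (\<integral>\<^sup>+x. g x \<partial>n)"
    have I: "integrable l (\<lambda>x. cos (a * x + c))" "integrable l (\<lambda>x. 1 :: real)"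
      if "sets l = sets borel" "finite_measure l" for a c and l :: "real measure"
      using that(1) by (auto intro!: finite_measure.integrable_const_bound[OF that(2), where B=1]
        simp: measurable_cong_sets[OF that(1) refl])
    have p: "(\<integral>x. (1 + cos (a * x + c)) / 2 \<partial>m) = (\<integral>x. (1 + cos (a * x + c)) / 2 \<partial>n)" for a c
    proof -
      have *: "(\<integral>x. (1 + cos (a * x + c)) / 2 \<partial>l) = enn2real (\<integral>\<^sup>+x. ennreal ((1 + cos (a * x + c)) / 2) \<partial>l)"
        if "sets l = sets borel" for l
        by (rule integral_eq_nn_integral) (use cb in \<open>auto simp: measurable_cong_sets[OF that refl]\<close>)
      have "(\<integral>\<^sup>+x. ennreal ((1 + cos (a * x + c)) / 2) \<partial>m) = (\<integral>\<^sup>+x. ennreal ((1 + cos (a * x + c)) / 2) \<partial>n)"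
        by (rule e) (auto simp: G_def intro!: image_eqI[of _ _ "(a,c)"])
      then show ?thesis by (simp only: *[OF s(1)] *[OF s(2)])
    qed
    have q: "(\<integral>x. (1 + cos (a * x + c)) / 2 \<partial>l) = (measure l (space l) + (\<integral>x. cos (a * x + c) \<partial>l)) / 2"
      if "sets l = sets borel" "finite_measure l" for a c and l :: "real measure"
      using I[OF that] by (simp add: finite_measure.emeasure_finite)
    have "measure m (space m) = measure n (space n)"
      using p[of 0 0] by simp
    then have "(\<integral>x. cos (a * x + c) \<partial>m) = (\<integral>x. cos (a * x + c) \<partial>n)" for a c
      using p[of a c] q[OF s(1) f(1)] q[OF s(2) f(2)] by simp
    then show "m = n" by (rule finite_borel_measure_eqI_cos[OF s f])
  next
    fix g :: "'k \<Rightarrow> real \<Rightarrow> ennreal"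
    assume g: "\<And>j. j \<in> J \<Longrightarrow> g j \<in> G"
    then have "\<forall>j\<in>J. \<exists>a c. g j = (\<lambda>x. ennreal ((1 + cos (a * x + c)) / 2))"
      by (fastforce simp: G_def)
    then obtain a c where ac: "\<And>j. j \<in> J \<Longrightarrow> g j = (\<lambda>x. ennreal ((1 + cos (a j * x + c j)) / 2))"
      by metis
    have gp: "(\<Prod>j\<in>J. g j (x j)) = ennreal (\<Prod>j\<in>J. (1 + cos (a j * x j + c j)) / 2)" for x
      using cb by (simp add: ac prod_ennreal)
    have meas: "(\<lambda>x. (\<Prod>j\<in>K. (1 + cos (a j * x j + c j)) / 2) * cos ((\<Sum>j\<in>J. b j * x j) + d))
        \<in> borel_measurable (PiM J (\<lambda>_. borel))" if "K \<subseteq> J" for K b d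
    proof -
      have [measurable]: "(\<lambda>x. x j) \<in> borel_measurable (PiM J (\<lambda>_. borel :: real measure))" if "j \<in> J" for j
        using that by simp
      have [measurable]: "(\<lambda>x. x j) \<in> borel_measurable (PiM J (\<lambda>_. borel :: real measure))" if "j \<in> K" for j
        using that \<open>K \<subseteq> J\<close> by auto
      show ?thesis by measurable
    qed
    have K: "(\<integral>x. (\<Prod>j\<in>K. (1 + cos (a j * x j + c j)) / 2) * cos ((\<Sum>j\<in>J. b j * x j) + d) \<partial>M)
        = (\<integral>x. (\<Prod>j\<in>K. (1 + cos (a j * x j + c j)) / 2) * cos ((\<Sum>j\<in>J. b j * x j) + d) \<partial>N)"
      if "K \<subseteq> J" for K b d
    proof -
      have "finite K" using that J by (rule finite_subset)
      then show ?thesis using that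
      proof (induction K arbitrary: b d)
        case empty
        then show ?case using eq by simp
      next
        case (insert k K)
        have kJ: "k \<in> J" and KJ: "K \<subseteq> J" using insert by auto
        define p where "p x = (\<Prod>j\<in>K. (1 + cos (a j * x j + c j)) / 2)" for x
        define b1 where "b1 = b(k := b k + a k)"
        define b2 where "b2 = b(k := b k - a k)"
        have b12: "(\<Sum>j\<in>J. b1 j * x j) = (\<Sum>j\<in>J. b j * x j) + a k * x k"
          "(\<Sum>j\<in>J. b2 j * x j) = (\<Sum>j\<in>J. b j * x j) - a k * x k" for x
          by (simp_all add: b1_def b2_def sum.remove[OF J kJ] algebra_simps)
        have exp: "(\<Prod>j\<in>insert k K. (1 + cos (a j * x j + c j)) / 2) * cos ((\<Sum>j\<in>J. b j * x j) + d)
           = p x * cos ((\<Sum>j\<in>J. b j * x j) + d) / 2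
             + p x * cos ((\<Sum>j\<in>J. b1 j * x j) + (d + c k)) / 4
             + p x * cos ((\<Sum>j\<in>J. b2 j * x j) + (d - c k)) / 4" for x
        proof -
          have "(\<Prod>j\<in>insert k K. (1 + cos (a j * x j + c j)) / 2) * cos ((\<Sum>j\<in>J. b j * x j) + d)
            = p x * ((1 + cos (a k * x k + c k)) / 2 * cos ((\<Sum>j\<in>J. b j * x j) + d))"
            using insert.hyps by (simp add: p_def)
          then show ?thesis unfolding trig b12 by (simp add: algebra_simps)
        qed
        have p1: "\<bar>p x\<bar> \<le> 1" for x
          unfolding p_def abs_prod using cb by (intro prod_le_1) auto
        have I: "integrable L (\<lambda>x. p x * cos ((\<Sum>j\<in>J. b j * x j) + d))"
          if "sets L = sets (PiM J (\<lambda>_. borel))" "finite_measure L" for L b d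
        proof (rule finite_measure.integrable_const_bound[OF that(2), where B=1])
          show "(\<lambda>x. p x * cos ((\<Sum>j\<in>J. b j * x j) + d)) \<in> borel_measurable L"
            using meas[OF KJ] that(1) by (simp add: p_def cong: measurable_cong_sets)
          have "norm (p x * cos y) \<le> 1" for x y
            using p1[of x] abs_cos_le_one[of y] mult_mono[of "\<bar>p x\<bar>" 1 "\<bar>cos y\<bar>" 1] by (simp add: abs_mult)
          then show "AE x in L. norm (p x * cos ((\<Sum>j\<in>J. b j * x j) + d)) \<le> 1" by simp
        qed
        have "(\<integral>x. p x * cos ((\<Sum>j\<in>J. b j * x j) + d) \<partial>M) = (\<integral>x. p x * cos ((\<Sum>j\<in>J. b j * x j) + d) \<partial>N)" for b d
          using insert.IH[OF KJ] by (simp add: p_def)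
        then show ?case unfolding exp using I[OF sM fM] I[OF sN fN] by simp
      qed
    qed
    have P: "(\<integral>x. (\<Prod>j\<in>J. (1 + cos (a j * x j + c j)) / 2) \<partial>M) = (\<integral>x. (\<Prod>j\<in>J. (1 + cos (a j * x j + c j)) / 2) \<partial>N)"
      using K[of J "\<lambda>_. 0" 0] by simp
    have "(\<integral>\<^sup>+x. (\<Prod>j\<in>J. g j (x j)) \<partial>L) = ennreal (\<integral>x. (\<Prod>j\<in>J. (1 + cos (a j * x j + c j)) / 2) \<partial>L)"
      if "sets L = sets (PiM J (\<lambda>_. borel))" "finite_measure L" for L
    proof -
      have "integrable L (\<lambda>x. \<Prod>j\<in>J. (1 + cos (a j * x j + c j)) / 2)"
      proof (rule finite_measure.integrable_const_bound[OF that(2), where B=1])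
        show "(\<lambda>x. \<Prod>j\<in>J. (1 + cos (a j * x j + c j)) / 2) \<in> borel_measurable L"
          using meas[of J "\<lambda>_. 0" 0] that(1) by (simp cong: measurable_cong_sets)
        show "AE x in L. norm (\<Prod>j\<in>J. (1 + cos (a j * x j + c j)) / 2) \<le> 1"
          using cb by (auto simp: abs_prod intro!: prod_le_1 AE_I2)
      qed
      then show ?thesis unfolding gp using cb by (intro nn_integral_eq_integral) (auto intro!: prod_nonneg)
    qed
    then show "(\<integral>\<^sup>+x. (\<Prod>j\<in>J. g j (x j)) \<partial>M) = (\<integral>\<^sup>+x. (\<Prod>j\<in>J. g j (x j)) \<partial>N)"
      using P sM sN fM fN by simp
  qed
qed

section \<open>The radial weight\<close>

lemma one_minus_cos_le: "1 - cos (x::real) \<le> x\<^sup>2"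
proof -
  have "1 - cos x = 2 * (sin (x/2))\<^sup>2" using cos_double_sin[of "x/2"] by simp
  also have "\<dots> \<le> 2 * (x/2)\<^sup>2"
    using abs_sin_x_le_abs_x[of "x/2"] by (simp only: abs_le_square_iff mult_le_cancel_left_pos zero_less_numeral)
  also have "\<dots> \<le> x\<^sup>2" by (simp add: power2_eq_square)
  finally show ?thesis .
qed

definition radial_weight :: "real \<Rightarrow> real \<Rightarrow> ennreal" where
  "radial_weight \<alpha> r = ennreal (\<bar>r\<bar> powr (- \<alpha> - 1))"

lemma measurable_radial_weight [measurable]: "radial_weight \<alpha> \<in> borel_measurable borel"
  unfolding radial_weight_def by measurable

text \<open>
  The homogeneity that produces the exponent \<open>\<alpha>\<close> in every formula below.
\<close>

lemma nn_integral_radial_scale: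
  assumes c: "c \<noteq> 0" and h[measurable]: "h \<in> borel_measurable borel"
  shows "(\<integral>\<^sup>+r. radial_weight \<alpha> r * h (c * r) \<partial>lborel)
       = ennreal (\<bar>c\<bar> powr \<alpha>) * (\<integral>\<^sup>+r. radial_weight \<alpha> r * h r \<partial>lborel)"
proof -
  have w: "radial_weight \<alpha> (c * r) = ennreal (\<bar>c\<bar> powr (- \<alpha> - 1)) * radial_weight \<alpha> r" for r
    by (simp add: radial_weight_def abs_mult powr_mult ennreal_mult)
  have "(\<integral>\<^sup>+r. radial_weight \<alpha> r * h r \<partial>lborel)
      = ennreal \<bar>c\<bar> * (\<integral>\<^sup>+r. radial_weight \<alpha> (c * r) * h (c * r) \<partial>lborel)"
    using nn_integral_real_affine[of "\<lambda>r. radial_weight \<alpha> r * h r" c 0] c by simp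
  also have "\<dots> = ennreal \<bar>c\<bar> * (ennreal (\<bar>c\<bar> powr (- \<alpha> - 1)) * (\<integral>\<^sup>+r. radial_weight \<alpha> r * h (c * r) \<partial>lborel))"
    by (simp add: w nn_integral_cmult mult.assoc)
  also have "\<dots> = ennreal (\<bar>c\<bar> powr (- \<alpha>)) * (\<integral>\<^sup>+r. radial_weight \<alpha> r * h (c * r) \<partial>lborel)"
  proof -
    have "\<bar>c\<bar> * \<bar>c\<bar> powr (- \<alpha> - 1) = \<bar>c\<bar> powr (- \<alpha>)"
      using c by (simp add: powr_diff)
    then show ?thesis by (simp add: mult.assoc[symmetric] ennreal_mult[symmetric])
  qed
  finally have e: "(\<integral>\<^sup>+r. radial_weight \<alpha> r * h r \<partial>lborel)
      = ennreal (\<bar>c\<bar> powr (- \<alpha>)) * (\<integral>\<^sup>+r. radial_weight \<alpha> r * h (c * r) \<partial>lborel)" .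
  have "\<bar>c\<bar> powr \<alpha> * \<bar>c\<bar> powr (- \<alpha>) = 1"
    using c by (simp add: powr_add[symmetric])
  then show ?thesis
    unfolding e by (simp add: mult.assoc[symmetric] ennreal_mult[symmetric])
qed

text \<open>
  These constants are the radial parts of the integrals against the Levy measure below. Being finite
  they keep those integrals finite, and being non-zero they can be cancelled.
\<close>

definition cos_const :: "real \<Rightarrow> ennreal" where
  "cos_const \<alpha> = (\<integral>\<^sup>+r. radial_weight \<alpha> r * ennreal (1 - cos r) \<partial>lborel)"

definition half_cos_const :: "real \<Rightarrow> ennreal" where
  "half_cos_const \<alpha> = (\<integral>\<^sup>+r. radial_weight \<alpha> r * (indicator {0<..} r * ennreal (1 - cos r)) \<partial>lborel)"

definition tail_const :: "real \<Rightarrow> ennreal" where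
  "tail_const \<alpha> = (\<integral>\<^sup>+r. radial_weight \<alpha> r * indicator {1<..} r \<partial>lborel)"

lemma tail_const_finite:
  assumes "0 < \<alpha>" shows "tail_const \<alpha> < \<top>"
proof -
  have "(\<integral>\<^sup>+r. ennreal (indicator {1..} r * r powr (-\<alpha>-1)) \<partial>lborel) = ennreal (- (1 powr ((-\<alpha>-1)+1)) / ((-\<alpha>-1)+1))"
    by (rule nn_integral_has_integral_lebesgue) (use assms has_integral_powr_to_inf[of "-\<alpha>-1" 1] in auto)
  moreover have "tail_const \<alpha> \<le> (\<integral>\<^sup>+r. ennreal (indicator {1..} r * r powr (-\<alpha>-1)) \<partial>lborel)"
    unfolding tail_const_def
    by (intro nn_integral_mono) (auto simp: radial_weight_def indicator_def)
  ultimately show ?thesis by (simp add: le_less_trans)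
qed

text \<open>
  The integrand is of order \<open>r\<^sup>1\<^sup>-\<^sup>\<alpha>\<close> near the origin, integrable since \<open>\<alpha> < 2\<close>, and at most twice the
  weight at infinity, integrable since \<open>\<alpha> > 0\<close>.
\<close>

lemma half_cos_const_finite:
  assumes "0 < \<alpha>" "\<alpha> < 2" shows "half_cos_const \<alpha> < \<top>"
proof -
  have 1: "(\<integral>\<^sup>+r. ennreal (indicator {0..1} r * r powr (1-\<alpha>)) \<partial>lborel) = ennreal (1 powr ((1-\<alpha>)+1) / ((1-\<alpha>)+1))"
    by (rule nn_integral_has_integral_lebesgue) (use assms has_integral_powr_from_0[of "1-\<alpha>" 1] in auto)
  have le: "radial_weight \<alpha> r * (indicator {0<..} r * ennreal (1 - cos r))
      \<le> ennreal (indicator {0..1} r * r powr (1-\<alpha>)) + 2 * (radial_weight \<alpha> r * indicator {1<..} r)" for r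
  proof -
    consider "r \<le> 0" | "0 < r" "r \<le> 1" | "1 < r" by linarith
    then show ?thesis
    proof cases
      case 2
      have "r powr (- \<alpha> - 1) * (1 - cos r) \<le> r powr (- \<alpha> - 1) * r\<^sup>2"
        by (intro mult_left_mono one_minus_cos_le) auto
      also have "\<dots> = r powr (1 - \<alpha>)"
        using 2 powr_add[of r "- \<alpha> - 1" 2] by simp
      finally show ?thesis using 2
        by (simp add: radial_weight_def ennreal_mult[symmetric])
    next
      case 3
      have "1 - cos r \<le> 2" using add_left_mono[OF cos_ge_minus_one[of r], of 1] by linarith
      then have "r powr (- \<alpha> - 1) * (1 - cos r) \<le> r powr (- \<alpha> - 1) * 2"
        by (intro mult_left_mono) auto
      then have "ennreal (r powr (- \<alpha> - 1) * (1 - cos r)) \<le> ennreal (r powr (- \<alpha> - 1) * 2)"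
        by (rule ennreal_leI)
      then show ?thesis using 3
        by (simp add: radial_weight_def ennreal_mult mult.commute)
    qed simp
  qed
  have "half_cos_const \<alpha> \<le> (\<integral>\<^sup>+r. ennreal (indicator {0..1} r * r powr (1-\<alpha>)) + 2 * (radial_weight \<alpha> r * indicator {1<..} r) \<partial>lborel)"
    unfolding half_cos_const_def by (intro nn_integral_mono le)
  also have "\<dots> = (\<integral>\<^sup>+r. ennreal (indicator {0..1} r * r powr (1-\<alpha>)) \<partial>lborel) + 2 * tail_const \<alpha>"
    unfolding tail_const_def by (subst nn_integral_add) (auto simp: nn_integral_cmult)
  also have "\<dots> < \<top>" using tail_const_finite[OF assms(1)] unfolding 1 by (simp add: ennreal_mult_less_top)
  finally show ?thesis .
qed

lemma cos_const_eq: "cos_const \<alpha> = 2 * half_cos_const \<alpha>"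
proof -
  define g where "g r = radial_weight \<alpha> r * (indicator {0<..} r * ennreal (1 - cos r))" for r
  have g[measurable]: "g \<in> borel_measurable borel" unfolding g_def by measurable
  have "cos_const \<alpha> = (\<integral>\<^sup>+r. g r + g (- r) \<partial>lborel)"
    unfolding cos_const_def g_def
    by (intro nn_integral_cong) (auto simp: radial_weight_def indicator_def)
  also have "\<dots> = (\<integral>\<^sup>+r. g r \<partial>lborel) + (\<integral>\<^sup>+r. g (- r) \<partial>lborel)"
    by (rule nn_integral_add) auto
  also have "(\<integral>\<^sup>+r. g (- r) \<partial>lborel) = (\<integral>\<^sup>+r. g r \<partial>lborel)"
    using nn_integral_real_affine[of g "-1" 0] by simp
  finally show ?thesis by (simp add: half_cos_const_def g_def mult_2)
qed

lemma nn_integral_lborel_pos_on_interval: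
  fixes g :: "real \<Rightarrow> ennreal"
  assumes g[measurable]: "g \<in> borel_measurable borel" and "a < b" and pos: "\<And>x. a < x \<Longrightarrow> x < b \<Longrightarrow> g x \<noteq> 0"
  shows "(\<integral>\<^sup>+x. g x \<partial>lborel) \<noteq> 0"
proof
  assume "(\<integral>\<^sup>+x. g x \<partial>lborel) = 0"
  then have "AE x in lborel. g x = 0" by (simp add: nn_integral_0_iff_AE)
  then have "AE x in lborel. x \<notin> {a<..<b}" by eventually_elim (use pos in auto)
  then have "emeasure lborel {a<..<b} = 0"
    using AE_iff_measurable[of "{a<..<b}" lborel "\<lambda>x. x \<notin> {a<..<b}"]
    by (simp add: greaterThanLessThan_def greaterThan_def lessThan_def Collect_conj_eq[symmetric] Int_def)
  then show False using \<open>a < b\<close> by simp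
qed

lemma half_cos_const_nonzero: "half_cos_const \<alpha> \<noteq> 0"
  unfolding half_cos_const_def
proof (rule nn_integral_lborel_pos_on_interval[of _ 0 1])
  fix r :: real assume r: "0 < r" "r < 1"
  then have "cos r < cos 0" using pi_gt3 by (intro cos_monotone_0_pi) auto
  then show "radial_weight \<alpha> r * (indicator {0<..} r * ennreal (1 - cos r)) \<noteq> 0"
    using r by (simp add: radial_weight_def)
qed auto

lemma tail_const_nonzero: "tail_const \<alpha> \<noteq> 0"
  unfolding tail_const_def
  by (rule nn_integral_lborel_pos_on_interval[of _ 1 2]) (auto simp: radial_weight_def)

section \<open>The Levy measure of a finite family of functions\<close>

text \<open>
  The radius \<open>r\<close> runs over both signs, which makes the measure symmetric: sine transforms vanish, and
  cosine transforms alone determine it.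
\<close>

definition levy_measure :: "real \<Rightarrow> 's measure \<Rightarrow> 'k set \<Rightarrow> ('k \<Rightarrow> 's \<Rightarrow> real) \<Rightarrow> ('k \<Rightarrow> real) measure" where
  "levy_measure \<alpha> M J f =
     distr (density (M \<Otimes>\<^sub>M lborel) (\<lambda>(s, r). radial_weight \<alpha> r)) (PiM J (\<lambda>_. borel))
       (\<lambda>(s, r). \<lambda>j\<in>J. r * f j s)"

lemma sets_levy_measure [simp, measurable_cong]: "sets (levy_measure \<alpha> M J f) = sets (PiM J (\<lambda>_. borel))"
  by (simp add: levy_measure_def)

lemma space_levy_measure [simp]: "space (levy_measure \<alpha> M J f) = space (PiM J (\<lambda>_. borel))"
  by (simp add: levy_measure_def)

lemma nn_integral_levy_measure:
  assumes f: "\<And>j. j \<in> J \<Longrightarrow> f j \<in> borel_measurable M" and h: "h \<in> borel_measurable (PiM J (\<lambda>_. borel))"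
  shows "(\<integral>\<^sup>+x. h x \<partial>levy_measure \<alpha> M J f)
       = (\<integral>\<^sup>+s. (\<integral>\<^sup>+r. radial_weight \<alpha> r * h (\<lambda>j\<in>J. r * f j s) \<partial>lborel) \<partial>M)"
proof -
  have [measurable]: "(\<lambda>z. \<lambda>j\<in>J. snd z * f j (fst z)) \<in> measurable (M \<Otimes>\<^sub>M lborel) (PiM J (\<lambda>_. borel))"
  proof (rule measurable_restrict)
    fix j assume "j \<in> J"
    note [measurable] = f[OF this]
    show "(\<lambda>z. snd z * f j (fst z)) \<in> borel_measurable (M \<Otimes>\<^sub>M lborel)" by measurable
  qed
  note [measurable] = h
  have "(\<integral>\<^sup>+x. h x \<partial>levy_measure \<alpha> M J f)
     = (\<integral>\<^sup>+z. radial_weight \<alpha> (snd z) * h (\<lambda>j\<in>J. snd z * f j (fst z)) \<partial>(M \<Otimes>\<^sub>M lborel))"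
    unfolding levy_measure_def split_beta'
    by (subst nn_integral_distr) (auto simp: nn_integral_density)
  also have "\<dots> = (\<integral>\<^sup>+s. (\<integral>\<^sup>+r. radial_weight \<alpha> r * h (\<lambda>j\<in>J. r * f j s) \<partial>lborel) \<partial>M)"
    by (subst lborel.nn_integral_fst[symmetric]) auto
  finally show ?thesis .
qed

lemma nn_integral_levy_measure_uminus:
  assumes f: "\<And>j. j \<in> J \<Longrightarrow> f j \<in> borel_measurable M" and h[measurable]: "h \<in> borel_measurable (PiM J (\<lambda>_. borel))"
  shows "(\<integral>\<^sup>+x. h (\<lambda>j\<in>J. - x j) \<partial>levy_measure \<alpha> M J f) = (\<integral>\<^sup>+x. h x \<partial>levy_measure \<alpha> M J f)"
proof -
  have [measurable]: "(\<lambda>x. \<lambda>j\<in>J. - x j) \<in> measurable (PiM J (\<lambda>_. borel)) (PiM J (\<lambda>_. borel :: real measure))"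
    by measurable
  have "(\<integral>\<^sup>+x. h (\<lambda>j\<in>J. - x j) \<partial>levy_measure \<alpha> M J f)
      = (\<integral>\<^sup>+s. (\<integral>\<^sup>+r. radial_weight \<alpha> r * h (\<lambda>j\<in>J. - ((\<lambda>j\<in>J. r * f j s) j)) \<partial>lborel) \<partial>M)"
    by (rule nn_integral_levy_measure[OF f]) auto
  also have "\<dots> = (\<integral>\<^sup>+s. (\<integral>\<^sup>+r. radial_weight \<alpha> r * h (\<lambda>j\<in>J. r * f j s) \<partial>lborel) \<partial>M)"
  proof (rule nn_integral_cong)
    fix s
    have [measurable]: "(\<lambda>r. \<lambda>j\<in>J. r * f j s) \<in> measurable borel (PiM J (\<lambda>_. borel))"
      by measurable
    have "(\<integral>\<^sup>+r. radial_weight \<alpha> r * h (\<lambda>j\<in>J. r * f j s) \<partial>lborel)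
        = (\<integral>\<^sup>+r. radial_weight \<alpha> (- r) * h (\<lambda>j\<in>J. - r * f j s) \<partial>lborel)"
      using nn_integral_real_affine[of "\<lambda>r. radial_weight \<alpha> r * h (\<lambda>j\<in>J. r * f j s)" "-1" 0] by simp
    also have "\<dots> = (\<integral>\<^sup>+r. radial_weight \<alpha> r * h (\<lambda>j\<in>J. - ((\<lambda>j\<in>J. r * f j s) j)) \<partial>lborel)"
      by (intro nn_integral_cong arg_cong2[where f="(*)"] arg_cong[where f=h])
         (auto simp: radial_weight_def restrict_def)
    finally show "(\<integral>\<^sup>+r. radial_weight \<alpha> r * h (\<lambda>j\<in>J. - ((\<lambda>j\<in>J. r * f j s) j)) \<partial>lborel)
        = (\<integral>\<^sup>+r. radial_weight \<alpha> r * h (\<lambda>j\<in>J. r * f j s) \<partial>lborel)" by simp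
  qed
  also have "\<dots> = (\<integral>\<^sup>+x. h x \<partial>levy_measure \<alpha> M J f)"
    by (rule nn_integral_levy_measure[OF f h, symmetric])
  finally show ?thesis .
qed

text \<open>
  On the ray through \<open>f s\<close> the integrand is \<open>1 - cos (c r)\<close> with \<open>c = \<Sum> a\<^sub>j f\<^sub>j s\<close>, so that
  \<open>nn_integral_radial_scale\<close> evaluates the radial integral as \<open>\<bar>c\<bar>\<^sup>\<alpha>\<close> times a constant.
\<close>

lemma levy_measure_cos:
  assumes J: "finite J" and f: "\<And>j. j \<in> J \<Longrightarrow> f j \<in> borel_measurable M"
  shows "(\<integral>\<^sup>+x. ennreal (1 - cos (\<Sum>j\<in>J. a j * x j)) \<partial>levy_measure \<alpha> M J f)
       = cos_const \<alpha> * (\<integral>\<^sup>+s. ennreal (\<bar>\<Sum>j\<in>J. a j * f j s\<bar> powr \<alpha>) \<partial>M)"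
proof -
  note [measurable] = f
  have inner: "(\<integral>\<^sup>+r. radial_weight \<alpha> r * ennreal (1 - cos (\<Sum>j\<in>J. a j * (\<lambda>j\<in>J. r * f j s) j)) \<partial>lborel)
     = cos_const \<alpha> * ennreal (\<bar>\<Sum>j\<in>J. a j * f j s\<bar> powr \<alpha>)" for s
  proof -
    define c where "c = (\<Sum>j\<in>J. a j * f j s)"
    have s: "(\<Sum>j\<in>J. a j * (\<lambda>j\<in>J. r * f j s) j) = c * r" for r
      by (simp add: c_def sum_distrib_left mult_ac)
    show ?thesis
    proof (cases "c = 0")
      case True
      then show ?thesis unfolding s c_def[symmetric] by simp
    next
      case False
      then show ?thesis unfolding s c_def[symmetric]
        using nn_integral_radial_scale[of c "\<lambda>r. ennreal (1 - cos r)" \<alpha>] by (simp add: cos_const_def mult.commute)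
    qed
  qed
  have "(\<integral>\<^sup>+x. ennreal (1 - cos (\<Sum>j\<in>J. a j * x j)) \<partial>levy_measure \<alpha> M J f)
     = (\<integral>\<^sup>+s. cos_const \<alpha> * ennreal (\<bar>\<Sum>j\<in>J. a j * f j s\<bar> powr \<alpha>) \<partial>M)"
    unfolding inner[symmetric] by (rule nn_integral_levy_measure[OF f]) auto
  then show ?thesis by (simp add: nn_integral_cmult)
qed

text \<open>
  For non-negative \<open>f\<close> the condition that some coordinate \<open>r f\<^sub>j s\<close> be positive just selects \<open>r > 0\<close>,
  unless \<open>f s = 0\<close>, where the integrand vanishes anyway. So half of the Levy measure already carries
  the full information about sums.
\<close>

lemma levy_measure_cos_positive_part:
  assumes J: "finite J" and f: "\<And>j. j \<in> J \<Longrightarrow> f j \<in> borel_measurable M"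
    and nn: "\<And>j. j \<in> J \<Longrightarrow> AE s in M. 0 \<le> f j s"
  shows "(\<integral>\<^sup>+x. indicator {x. \<exists>j\<in>J. 0 < x j} x * ennreal (1 - cos (\<Sum>j\<in>J. a j * x j)) \<partial>levy_measure \<alpha> M J f)
       = half_cos_const \<alpha> * (\<integral>\<^sup>+s. ennreal (\<bar>\<Sum>j\<in>J. a j * f j s\<bar> powr \<alpha>) \<partial>M)"
proof -
  note [measurable] = f
  have nn': "AE s in M. \<forall>j\<in>J. 0 \<le> f j s" using J nn by (simp add: AE_finite_all)
  have inner: "(\<integral>\<^sup>+r. radial_weight \<alpha> r * (indicator {x. \<exists>j\<in>J. 0 < x j} (\<lambda>j\<in>J. r * f j s)
        * ennreal (1 - cos (\<Sum>j\<in>J. a j * (\<lambda>j\<in>J. r * f j s) j))) \<partial>lborel)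
     = half_cos_const \<alpha> * ennreal (\<bar>\<Sum>j\<in>J. a j * f j s\<bar> powr \<alpha>)" if pos: "\<forall>j\<in>J. 0 \<le> f j s" for s
  proof -
    define c where "c = (\<Sum>j\<in>J. a j * f j s)"
    have s: "(\<Sum>j\<in>J. a j * (\<lambda>j\<in>J. r * f j s) j) = c * r" for r
      by (simp add: c_def sum_distrib_left mult_ac)
    show ?thesis
    proof (cases "c = 0")
      case True
      then show ?thesis unfolding s c_def[symmetric] by simp
    next
      case False
      then obtain k where "k \<in> J" "a k * f k s \<noteq> 0" unfolding c_def by (rule sum.not_neutral_contains_not_neutral)
      with pos have k: "k \<in> J" "0 < f k s" by (auto simp: less_le)
      have ind: "(indicator {x. \<exists>j\<in>J. 0 < x j} (\<lambda>j\<in>J. r * f j s) :: ennreal) = indicator {0<..} (\<bar>c\<bar> * r)" for r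
      proof -
        have "(\<exists>j\<in>J. 0 < r * f j s) \<longleftrightarrow> 0 < r"
          using k pos by (auto simp: zero_less_mult_iff not_less[symmetric] dest: bspec)
        also have "\<dots> \<longleftrightarrow> 0 < \<bar>c\<bar> * r" using False by (simp add: zero_less_mult_iff)
        finally show ?thesis by (auto simp: indicator_def)
      qed
      have cos: "cos (c * r) = cos (\<bar>c\<bar> * r)" for r by (cases "c \<ge> 0") (auto simp: abs_if)
      show ?thesis unfolding s c_def[symmetric] ind cos
        using nn_integral_radial_scale[of "\<bar>c\<bar>" "\<lambda>r. indicator {0<..} r * ennreal (1 - cos r)" \<alpha>] False
        by (simp add: half_cos_const_def mult.commute)
    qed
  qed
  have "(\<integral>\<^sup>+x. indicator {x. \<exists>j\<in>J. 0 < x j} x * ennreal (1 - cos (\<Sum>j\<in>J. a j * x j)) \<partial>levy_measure \<alpha> M J f)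
     = (\<integral>\<^sup>+s. (\<integral>\<^sup>+r. radial_weight \<alpha> r * (indicator {x. \<exists>j\<in>J. 0 < x j} (\<lambda>j\<in>J. r * f j s)
        * ennreal (1 - cos (\<Sum>j\<in>J. a j * (\<lambda>j\<in>J. r * f j s) j))) \<partial>lborel) \<partial>M)"
    by (rule nn_integral_levy_measure[OF f]) (use J in auto)
  also have "\<dots> = (\<integral>\<^sup>+s. half_cos_const \<alpha> * ennreal (\<bar>\<Sum>j\<in>J. a j * f j s\<bar> powr \<alpha>) \<partial>M)"
    by (rule nn_integral_cong_AE) (use nn' in eventually_elim, rule inner)
  finally show ?thesis by (simp add: nn_integral_cmult)
qed

text \<open>
  With \<open>m = max f\<^sub>j s / a\<^sub>j\<close>, the point \<open>r f s\<close> exceeds some level \<open>a\<^sub>j\<close> exactly when \<open>m r > 1\<close>, and the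
  radial mass of this half-line is \<open>m\<^sup>\<alpha>\<close> times a constant.
\<close>

lemma levy_measure_exceedance:
  assumes J: "finite J" "J \<noteq> {}" and f: "\<And>j. j \<in> J \<Longrightarrow> f j \<in> borel_measurable M"
    and nn: "\<And>j. j \<in> J \<Longrightarrow> AE s in M. 0 \<le> f j s" and a: "\<And>j. j \<in> J \<Longrightarrow> 0 < a j"
  shows "emeasure (levy_measure \<alpha> M J f) {x \<in> space (PiM J (\<lambda>_. borel)). \<exists>j\<in>J. a j < x j}
       = tail_const \<alpha> * (\<integral>\<^sup>+s. ennreal ((MAX j\<in>J. f j s / a j) powr \<alpha>) \<partial>M)"
proof -
  note [measurable] = f
  let ?E = "{x \<in> space (PiM J (\<lambda>_. borel)). \<exists>j\<in>J. a j < x j}"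
  have E[measurable]: "?E \<in> sets (PiM J (\<lambda>_. borel))" using J by measurable
  have nn': "AE s in M. \<forall>j\<in>J. 0 \<le> f j s" using J nn by (simp add: AE_finite_all)
  have inner: "(\<integral>\<^sup>+r. radial_weight \<alpha> r * indicator ?E (\<lambda>j\<in>J. r * f j s) \<partial>lborel)
     = tail_const \<alpha> * ennreal ((MAX j\<in>J. f j s / a j) powr \<alpha>)" if pos: "\<forall>j\<in>J. 0 \<le> f j s" for s
  proof -
    define m where "m = (MAX j\<in>J. f j s / a j)"
    have m_ge: "f j s / a j \<le> m" if "j \<in> J" for j using that J by (simp add: m_def)
    have "m \<in> (\<lambda>j. f j s / a j) ` J" unfolding m_def using J by (intro Max_in) auto
    then obtain k where k: "k \<in> J" "m = f k s / a k" by auto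
    have m0: "0 \<le> m" using k pos a by (simp add: zero_le_divide_iff less_imp_le)
    have "(\<exists>j\<in>J. a j < r * f j s) \<longleftrightarrow> 1 < m * r" for r
    proof
      assume "\<exists>j\<in>J. a j < r * f j s"
      then obtain j where j: "j \<in> J" "a j < r * f j s" by auto
      then have "0 < r * f j s" using a[of j] by simp
      then have r: "0 < r" using pos j by (auto simp: zero_less_mult_iff dest: bspec)
      have "1 < r * (f j s / a j)" using j a[of j] by (simp add: field_simps)
      also have "\<dots> \<le> r * m" using m_ge[OF j(1)] r by (intro mult_left_mono) auto
      finally show "1 < m * r" by (simp add: mult.commute)
    next
      assume "1 < m * r"
      then have "a k < r * f k s" using k a[of k] by (simp add: field_simps)
      then show "\<exists>j\<in>J. a j < r * f j s" using k by blast
    qed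
    then have ind: "(indicator ?E (\<lambda>j\<in>J. r * f j s) :: ennreal) = indicator {1<..} (m * r)" for r
      by (simp add: indicator_def space_PiM)
    show ?thesis
    proof (cases "m = 0")
      case True
      then show ?thesis unfolding ind m_def[symmetric] by simp
    next
      case False
      then show ?thesis unfolding ind m_def[symmetric]
        using nn_integral_radial_scale[of m "indicator {1<..}" \<alpha>] m0 by (simp add: tail_const_def mult.commute)
    qed
  qed
  have "emeasure (levy_measure \<alpha> M J f) ?E = (\<integral>\<^sup>+x. indicator ?E x \<partial>levy_measure \<alpha> M J f)"
    using E by simp
  also have "\<dots> = (\<integral>\<^sup>+s. (\<integral>\<^sup>+r. radial_weight \<alpha> r * indicator ?E (\<lambda>j\<in>J. r * f j s) \<partial>lborel) \<partial>M)"
    by (rule nn_integral_levy_measure[OF f]) auto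
  also have "\<dots> = (\<integral>\<^sup>+s. tail_const \<alpha> * ennreal ((MAX j\<in>J. f j s / a j) powr \<alpha>) \<partial>M)"
    by (rule nn_integral_cong_AE) (use nn' in eventually_elim, rule inner)
  also have "\<dots> = tail_const \<alpha> * (\<integral>\<^sup>+s. ennreal ((MAX j\<in>J. f j s / a j) powr \<alpha>) \<partial>M)"
    using J by (intro nn_integral_cmult) measurable
  finally show ?thesis .
qed

section \<open>Recovering the Levy measure\<close>

lemma distr_levy_measure_uminus:
  assumes f: "\<And>j. j \<in> J \<Longrightarrow> f j \<in> borel_measurable M"
  shows "distr (levy_measure \<alpha> M J f) (levy_measure \<alpha> M J f) (\<lambda>x. \<lambda>j\<in>J. - x j) = levy_measure \<alpha> M J f"
    (is "distr ?L ?L ?neg = ?L")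
proof (rule measure_eqI)
  have neg: "?neg \<in> measurable ?L ?L" by measurable
  fix A assume "A \<in> sets (distr ?L ?L ?neg)"
  then have A: "A \<in> sets ?L" by simp
  have "emeasure (distr ?L ?L ?neg) A = (\<integral>\<^sup>+x. indicator A x \<partial>distr ?L ?L ?neg)" using A by simp
  also have "\<dots> = (\<integral>\<^sup>+x. indicator A (?neg x) \<partial>?L)" using neg A by (subst nn_integral_distr) auto
  also have "\<dots> = (\<integral>\<^sup>+x. indicator A x \<partial>?L)"
    using A by (intro nn_integral_levy_measure_uminus[OF f]) auto
  finally show "emeasure (distr ?L ?L ?neg) A = emeasure ?L A" using A by simp
qed simp

text \<open>
  Near the origin the weight is of second order, which makes a Levy measure finite. The frequencies
  \<open>1\<close> and \<open>\<surd>2\<close> are incommensurable, so that the two cosines of a coordinate equal \<open>1\<close> simultaneously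
  only when it is \<open>0\<close>.
\<close>

definition origin_weight :: "'k set \<Rightarrow> ('k \<Rightarrow> real) \<Rightarrow> real" where
  "origin_weight J x = (\<Sum>j\<in>J. \<Sum>s\<in>{1, sqrt 2}. 1 - cos (s * x j))"

lemma origin_weight_nonneg: "0 \<le> origin_weight J x"
  unfolding origin_weight_def by (intro sum_nonneg) simp

lemma cos_eq_1_both:
  assumes "cos x = 1" "cos (sqrt 2 * x) = 1"
  shows "x = 0"
proof (rule ccontr)
  assume x: "x \<noteq> 0"
  obtain m :: int where m: "x = of_int m * 2 * pi" using assms(1) by (auto simp: cos_one_2pi_int)
  obtain n :: int where n: "sqrt 2 * x = of_int n * 2 * pi" using assms(2) by (auto simp: cos_one_2pi_int)
  have m0: "m \<noteq> 0" using x m by auto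
  have "sqrt 2 * of_int m = of_int n" using m n by simp
  then have "(sqrt 2 * of_int m)\<^sup>2 = (of_int n :: real)\<^sup>2" by simp
  then have "real_of_int (2 * m\<^sup>2) = real_of_int (n\<^sup>2)" by (simp add: power_mult_distrib)
  then have e: "2 * m\<^sup>2 = n\<^sup>2" by (simp only: of_int_eq_iff)
  then have n0: "n \<noteq> 0" using m0 by auto
  have p: "prime_elem (2::int)" by simp
  \<comment> \<open>the exponent of \<open>2\<close> is odd on one side of \<open>2 m\<^sup>2 = n\<^sup>2\<close> and even on the other\<close>
  have "multiplicity 2 (2 * m\<^sup>2) = 1 + 2 * multiplicity 2 m"
    using m0 p by (simp add: prime_elem_multiplicity_mult_distrib prime_elem_multiplicity_power_distrib)
  moreover have "multiplicity 2 (n\<^sup>2) = 2 * multiplicity 2 n"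
    using n0 p by (simp add: prime_elem_multiplicity_power_distrib)
  ultimately have "1 + 2 * multiplicity 2 m = 2 * multiplicity 2 n" using e by simp
  then show False by presburger
qed

lemma origin_weight_pos:
  assumes J: "finite J" and k: "k \<in> J" "x k \<noteq> 0"
  shows "0 < origin_weight J x"
  unfolding origin_weight_def
proof (rule sum_pos2[OF J k(1)])
  have "cos (x k) \<noteq> 1 \<or> cos (sqrt 2 * x k) \<noteq> 1" using cos_eq_1_both k by auto
  moreover have "cos (x k) \<le> 1" "cos (sqrt 2 * x k) \<le> 1" by simp_all
  ultimately have "0 < (1 - cos (x k)) + (1 - cos (sqrt 2 * x k))" by linarith
  then show "0 < (\<Sum>s\<in>{1, sqrt 2}. 1 - cos (s * x k))" by simp
qed (rule sum_nonneg, simp)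

lemma measurable_origin_weight [measurable]:
  "origin_weight J \<in> borel_measurable (PiM J (\<lambda>_. borel))"
  unfolding origin_weight_def by measurable

text \<open>
  The transform of the weighted measure in terms of the exponent \<open>D\<close>: by the product-to-sum formula,
  \<open>(1 - cos (s x\<^sub>k)) cos u\<close> is the second difference \<open>((1 - cos (u + s x\<^sub>k)) + (1 - cos (u - s x\<^sub>k))) / 2 - (1 - cos u)\<close>,
  every term of which is integrable although \<open>cos u\<close> itself need not be. Symmetry removes the sine terms that
  the phase \<open>c\<close> brings in.
\<close>

lemma integral_origin_weight_cos:
  fixes L :: "('k \<Rightarrow> real) measure"
  assumes J: "finite J" and sL[measurable_cong]: "sets L = sets (PiM J (\<lambda>_. borel))"
    and sym: "distr L L (\<lambda>x. \<lambda>j\<in>J. - x j) = L"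
    and I: "\<And>b. integrable L (\<lambda>x. 1 - cos (\<Sum>j\<in>J. b j * x j))"
  defines "D \<equiv> \<lambda>b. \<integral>x. 1 - cos (\<Sum>j\<in>J. b j * x j) \<partial>L"
  shows "integrable L (origin_weight J)"
    and "(\<integral>x. origin_weight J x * cos ((\<Sum>j\<in>J. a j * x j) + c) \<partial>L)
      = cos c * (\<Sum>k\<in>J. \<Sum>s\<in>{1, sqrt 2}. (D (a(k := a k + s)) + D (a(k := a k - s))) / 2 - D a)"
proof -
  define u where "u b x = (\<Sum>j\<in>J. b j * x j)" for b x :: "'k \<Rightarrow> real"
  have um[measurable]: "u b \<in> borel_measurable L" for b unfolding u_def by measurable
  define q where "q b = (\<lambda>x. 1 - cos (u b x))" for b
  have Iq: "integrable L (q b)" for b using I by (simp add: q_def u_def)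
  have D: "D b = (\<integral>x. q b x \<partial>L)" for b by (simp add: D_def q_def u_def)
  have W: "origin_weight J x * cos (u b x)
     = (\<Sum>k\<in>J. \<Sum>s\<in>{1, sqrt 2}. (q (b(k := b k + s)) x + q (b(k := b k - s)) x) / 2 - q b x)" for b x
  proof -
    have "(1 - cos (s * x k)) * cos (u b x) = (q (b(k := b k + s)) x + q (b(k := b k - s)) x) / 2 - q b x"
      if k: "k \<in> J" for k s
    proof -
      have e: "u (b(k := b k + s)) x = u b x + s * x k" "u (b(k := b k - s)) x = u b x - s * x k"
        by (simp_all add: u_def sum.remove[OF J k] algebra_simps)
      show ?thesis unfolding q_def e by (simp add: cos_add cos_diff field_simps)
    qed
    then show ?thesis unfolding origin_weight_def sum_distrib_right by (intro sum.cong refl) simp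
  qed
  have Wc: "integrable L (\<lambda>x. origin_weight J x * cos (u b x))" for b
    unfolding W by (intro Bochner_Integration.integrable_sum Bochner_Integration.integrable_diff
        integrable_divide_zero Bochner_Integration.integrable_add Iq)
  show IW: "integrable L (origin_weight J)"
    using Wc[of "\<lambda>_. 0"] by (simp add: u_def)
  have Ws: "integrable L (\<lambda>x. origin_weight J x * sin (u a x))"
    by (rule Bochner_Integration.integrable_bound[OF IW])
       (use sL in \<open>simp_all add: abs_mult abs_of_nonneg[OF origin_weight_nonneg] mult_left_le origin_weight_nonneg\<close>)
  have cosint: "(\<integral>x. origin_weight J x * cos (u a x) \<partial>L)
      = (\<Sum>k\<in>J. \<Sum>s\<in>{1, sqrt 2}. (D (a(k := a k + s)) + D (a(k := a k - s))) / 2 - D a)"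
    unfolding W D by (simp add: Iq)
  have sinint: "(\<integral>x. origin_weight J x * sin (u a x) \<partial>L) = 0"
  proof -
    have neg: "(\<lambda>x. \<lambda>j\<in>J. - x j) \<in> measurable L L" by measurable
    have "(\<integral>x. origin_weight J x * sin (u a x) \<partial>L)
        = (\<integral>x. origin_weight J x * sin (u a x) \<partial>distr L L (\<lambda>x. \<lambda>j\<in>J. - x j))"
      by (simp add: sym)
    also have "\<dots> = (\<integral>x. origin_weight J (\<lambda>j\<in>J. - x j) * sin (u a (\<lambda>j\<in>J. - x j)) \<partial>L)"
      by (rule integral_distr[OF neg]) measurable
    also have "\<dots> = (\<integral>x. - (origin_weight J x * sin (u a x)) \<partial>L)"
      by (intro Bochner_Integration.integral_cong) (simp_all add: origin_weight_def u_def sum_negf)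
    also have "\<dots> = - (\<integral>x. origin_weight J x * sin (u a x) \<partial>L)" by simp
    finally show ?thesis by simp
  qed
  have "(\<integral>x. origin_weight J x * cos (u a x + c) \<partial>L)
      = (\<integral>x. cos c * (origin_weight J x * cos (u a x)) - sin c * (origin_weight J x * sin (u a x)) \<partial>L)"
    by (simp add: cos_add algebra_simps)
  also have "\<dots> = cos c * (\<integral>x. origin_weight J x * cos (u a x) \<partial>L)
      - sin c * (\<integral>x. origin_weight J x * sin (u a x) \<partial>L)"
    using Wc[of a] Ws by simp
  finally show "(\<integral>x. origin_weight J x * cos ((\<Sum>j\<in>J. a j * x j) + c) \<partial>L)
      = cos c * (\<Sum>k\<in>J. \<Sum>s\<in>{1, sqrt 2}. (D (a(k := a k + s)) + D (a(k := a k - s))) / 2 - D a)"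
    unfolding cosint sinint by (simp add: u_def)
qed

text \<open>
  The weighted Levy measures are finite and have equal transforms, hence coincide; dividing by the
  weight, positive off the origin, recovers the Levy measures themselves.
\<close>

lemma levy_measure_eq_off_origin:
  fixes f :: "'k \<Rightarrow> 's \<Rightarrow> real" and g :: "'k \<Rightarrow> 't \<Rightarrow> real"
  assumes \<alpha>: "0 < \<alpha>" "\<alpha> < 2" and J: "finite J"
    and f: "\<And>j. j \<in> J \<Longrightarrow> f j \<in> borel_measurable M" and g: "\<And>j. j \<in> J \<Longrightarrow> g j \<in> borel_measurable N"
    and fin: "\<And>a. (\<integral>\<^sup>+s. ennreal (\<bar>\<Sum>j\<in>J. a j * f j s\<bar> powr \<alpha>) \<partial>M) < \<top>"
    and eq: "\<And>a. (\<integral>\<^sup>+s. ennreal (\<bar>\<Sum>j\<in>J. a j * f j s\<bar> powr \<alpha>) \<partial>M)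
               = (\<integral>\<^sup>+s. ennreal (\<bar>\<Sum>j\<in>J. a j * g j s\<bar> powr \<alpha>) \<partial>N)"
    and A: "A \<in> sets (PiM J (\<lambda>_. borel))" "\<And>x. x \<in> A \<Longrightarrow> \<exists>j\<in>J. x j \<noteq> 0"
  shows "emeasure (levy_measure \<alpha> M J f) A = emeasure (levy_measure \<alpha> N J g) A"
proof -
  define L1 where "L1 = levy_measure \<alpha> M J f"
  define L2 where "L2 = levy_measure \<alpha> N J g"
  have s[measurable_cong]: "sets L1 = sets (PiM J (\<lambda>_. borel))" "sets L2 = sets (PiM J (\<lambda>_. borel))"
    by (simp_all add: L1_def L2_def)
  have c: "(\<integral>\<^sup>+x. ennreal (1 - cos (\<Sum>j\<in>J. b j * x j)) \<partial>L1) = (\<integral>\<^sup>+x. ennreal (1 - cos (\<Sum>j\<in>J. b j * x j)) \<partial>L2)" for b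
    unfolding L1_def L2_def by (simp only: levy_measure_cos[of J f M, OF J f] levy_measure_cos[of J g N, OF J g] eq)
  have c1: "(\<integral>\<^sup>+x. ennreal (1 - cos (\<Sum>j\<in>J. b j * x j)) \<partial>L1) < \<infinity>" for b
    unfolding L1_def using half_cos_const_finite[OF \<alpha>]
    by (simp add: levy_measure_cos[of J f M, OF J f] cos_const_eq ennreal_mult_less_top fin)
  have c2: "(\<integral>\<^sup>+x. ennreal (1 - cos (\<Sum>j\<in>J. b j * x j)) \<partial>L2) < \<infinity>" for b
    using c1 c by simp
  have I1: "integrable L1 (\<lambda>x. 1 - cos (\<Sum>j\<in>J. b j * x j))" for b
    by (rule integrableI_nonneg) (use c1 in auto)
  have I2: "integrable L2 (\<lambda>x. 1 - cos (\<Sum>j\<in>J. b j * x j))" for b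
    by (rule integrableI_nonneg) (use c2 in auto)
  have D: "(\<integral>x. 1 - cos (\<Sum>j\<in>J. b j * x j) \<partial>L1) = (\<integral>x. 1 - cos (\<Sum>j\<in>J. b j * x j) \<partial>L2)" for b
  proof -
    have "(\<integral>x. 1 - cos (\<Sum>j\<in>J. b j * x j) \<partial>L) = enn2real (\<integral>\<^sup>+x. ennreal (1 - cos (\<Sum>j\<in>J. b j * x j)) \<partial>L)"
      if [measurable_cong]: "sets L = sets (PiM J (\<lambda>_. borel))" for L
      by (rule integral_eq_nn_integral) auto
    then show ?thesis using s c by simp
  qed
  have sym: "distr L1 L1 (\<lambda>x. \<lambda>j\<in>J. - x j) = L1" "distr L2 L2 (\<lambda>x. \<lambda>j\<in>J. - x j) = L2"
    unfolding L1_def L2_def by (rule distr_levy_measure_uminus[OF f] distr_levy_measure_uminus[OF g]; simp)+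
  note W1 = integral_origin_weight_cos[OF J s(1) sym(1) I1]
  note W2 = integral_origin_weight_cos[OF J s(2) sym(2) I2]
  define w where "w x = ennreal (origin_weight J x)" for x
  have w[measurable]: "w \<in> borel_measurable (PiM J (\<lambda>_. borel))" unfolding w_def by measurable
  have fin_w: "finite_measure (density L w)"
    if [measurable_cong]: "sets L = sets (PiM J (\<lambda>_. borel))" and "integrable L (origin_weight J)" for L
  proof (rule finite_measureI)
    have "emeasure (density L w) (space L) = (\<integral>\<^sup>+x. w x \<partial>L)"
      by (subst emeasure_density) (auto intro!: nn_integral_cong)
    also have "\<dots> < \<top>" using that(2) by (simp add: integrable_iff_bounded w_def abs_of_nonneg[OF origin_weight_nonneg])
    finally show "emeasure (density L w) (space (density L w)) \<noteq> \<infinity>" by simp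
  qed
  have dens: "density L1 w = density L2 w"
  proof (rule finite_measure_eqI_cos[OF J])
    show "finite_measure (density L1 w)" "finite_measure (density L2 w)"
      using fin_w s W1(1) W2(1) by auto
    fix a :: "'k \<Rightarrow> real" and c :: real
    have "(\<integral>x. cos ((\<Sum>j\<in>J. a j * x j) + c) \<partial>density L w) = (\<integral>x. origin_weight J x * cos ((\<Sum>j\<in>J. a j * x j) + c) \<partial>L)"
      if [measurable_cong]: "sets L = sets (PiM J (\<lambda>_. borel))" for L
      unfolding w_def by (subst integral_density) (auto simp: origin_weight_nonneg)
    then show "(\<integral>x. cos ((\<Sum>j\<in>J. a j * x j) + c) \<partial>density L1 w) = (\<integral>x. cos ((\<Sum>j\<in>J. a j * x j) + c) \<partial>density L2 w)"
      by (simp only: s W1(2) W2(2) D)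
  qed (use s in auto)
  \<comment> \<open>\<open>1 / w\<close> undoes the weight on \<open>A\<close>, where \<open>w\<close> is positive\<close>
  have rec: "emeasure L A = (\<integral>\<^sup>+x. indicator A x / w x \<partial>density L w)"
    if [measurable_cong]: "sets L = sets (PiM J (\<lambda>_. borel))" for L
  proof -
    have [measurable]: "A \<in> sets L" using A that by simp
    have "(\<integral>\<^sup>+x. indicator A x / w x \<partial>density L w) = (\<integral>\<^sup>+x. w x * (indicator A x / w x) \<partial>L)"
      by (rule nn_integral_density) auto
    also have "\<dots> = (\<integral>\<^sup>+x. indicator A x \<partial>L)"
    proof (intro nn_integral_cong)
      fix x
      show "w x * (indicator A x / w x) = indicator A x"
      proof (cases "x \<in> A")
        case True
        then have "0 < origin_weight J x" using A(2) origin_weight_pos[OF J] by blast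
        then show ?thesis using True
          by (simp add: w_def divide_ennreal_def ennreal_mult_divide_eq inverse_ennreal ennreal_mult[symmetric])
      qed simp
    qed
    finally show ?thesis by simp
  qed
  show ?thesis using rec[OF s(1)] rec[OF s(2)] dens by (simp add: L1_def L2_def)
qed

text \<open>
  Non-negative \<open>f\<close> make each ray \<open>r f s\<close> run through the non-negative orthant for \<open>r \<ge> 0\<close> and through
  its reflection for \<open>r \<le> 0\<close>.
\<close>

lemma levy_measure_nonneg:
  assumes J: "finite J" and f: "\<And>j. j \<in> J \<Longrightarrow> f j \<in> borel_measurable M"
    and nn: "\<And>j. j \<in> J \<Longrightarrow> AE s in M. 0 \<le> f j s"
  shows "AE x in levy_measure \<alpha> M J f. (\<exists>j\<in>J. 0 < x j) \<longrightarrow> (\<forall>j\<in>J. 0 \<le> x j)"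
proof -
  have nn': "AE s in M. \<forall>j\<in>J. 0 \<le> f j s" using J nn by (simp add: AE_finite_all)
  define P where "P x \<longleftrightarrow> (\<exists>j\<in>J. 0 < x j) \<and> \<not> (\<forall>j\<in>J. 0 \<le> x j)" for x :: "'a \<Rightarrow> real"
  define h :: "('a \<Rightarrow> real) \<Rightarrow> ennreal" where "h x = (if P x then 1 else 0)" for x
  have h[measurable]: "h \<in> borel_measurable (PiM J (\<lambda>_. borel))"
    unfolding h_def P_def using J by measurable
  have "(\<integral>\<^sup>+x. h x \<partial>levy_measure \<alpha> M J f)
      = (\<integral>\<^sup>+s. (\<integral>\<^sup>+r. radial_weight \<alpha> r * h (\<lambda>j\<in>J. r * f j s) \<partial>lborel) \<partial>M)"
    by (rule nn_integral_levy_measure[OF f]) auto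
  also have "\<dots> = (\<integral>\<^sup>+s. 0 \<partial>M)"
  proof (rule nn_integral_cong_AE, use nn' in eventually_elim)
    fix s assume pos: "\<forall>j\<in>J. 0 \<le> f j s"
    have "h (\<lambda>j\<in>J. r * f j s) = 0" for r
    proof -
      have "\<not> P (\<lambda>j\<in>J. r * f j s)"
      proof
        assume P: "P (\<lambda>j\<in>J. r * f j s)"
        then obtain k where k: "k \<in> J" "0 < r * f k s" unfolding P_def by auto
        then have "0 < r" using pos by (meson mult_nonpos_nonneg not_less)
        then have "\<forall>j\<in>J. 0 \<le> (\<lambda>j\<in>J. r * f j s) j" using pos by simp
        with P show False unfolding P_def by blast
      qed
      then show ?thesis by (simp add: h_def)
    qed
    then show "(\<integral>\<^sup>+r. radial_weight \<alpha> r * h (\<lambda>j\<in>J. r * f j s) \<partial>lborel) = 0" by simp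
  qed
  finally have "AE x in levy_measure \<alpha> M J f. h x = 0" by (simp add: nn_integral_0_iff_AE)
  then show ?thesis by eventually_elim (auto simp: h_def P_def split: if_splits)
qed

text \<open>
  The measures may be infinite near the origin, so they are first cut off at level \<open>e\<close>. On the
  region \<open>E e\<close> where some coordinate exceeds \<open>e\<close>, the distribution function at \<open>a\<close> is the mass of the
  exceedance region of \<open>min a e\<close> minus that of \<open>a\<close>. Monotone limits as \<open>e\<close> decreases to \<open>0\<close> then
  cover the whole positive part.
\<close>

lemma measure_eq_on_positive_part:
  fixes L1 L2 :: "('k \<Rightarrow> real) measure"
  assumes J: "finite J"
    and s[measurable_cong]: "sets L1 = sets (PiM J (\<lambda>_. borel))" "sets L2 = sets (PiM J (\<lambda>_. borel))"
    and n1: "AE x in L1. (\<exists>j\<in>J. 0 < x j) \<longrightarrow> (\<forall>j\<in>J. 0 \<le> x j)"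
    and n2: "AE x in L2. (\<exists>j\<in>J. 0 < x j) \<longrightarrow> (\<forall>j\<in>J. 0 \<le> x j)"
    and fin: "\<And>a. (\<And>j. j \<in> J \<Longrightarrow> 0 < a j) \<Longrightarrow> emeasure L1 {x \<in> space (PiM J (\<lambda>_. borel)). \<exists>j\<in>J. a j < x j} < \<top>"
    and eq: "\<And>a. (\<And>j. j \<in> J \<Longrightarrow> 0 < a j) \<Longrightarrow>
        emeasure L1 {x \<in> space (PiM J (\<lambda>_. borel)). \<exists>j\<in>J. a j < x j}
      = emeasure L2 {x \<in> space (PiM J (\<lambda>_. borel)). \<exists>j\<in>J. a j < x j}"
    and h[measurable]: "h \<in> borel_measurable (PiM J (\<lambda>_. borel))"
  shows "(\<integral>\<^sup>+x. indicator {x. \<exists>j\<in>J. 0 < x j} x * h x \<partial>L1) = (\<integral>\<^sup>+x. indicator {x. \<exists>j\<in>J. 0 < x j} x * h x \<partial>L2)"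
proof -
  define E where "E a = {x \<in> space (PiM J (\<lambda>_. borel)). \<exists>j\<in>J. a j < x j}" for a :: "'k \<Rightarrow> real"
  have E[measurable]: "E a \<in> sets (PiM J (\<lambda>_. borel))" for a unfolding E_def using J by measurable
  have E_mono: "E (\<lambda>_. e) \<subseteq> E (\<lambda>_. e')" if "e' \<le> e" for e e'
    using that unfolding E_def by (auto intro: le_less_trans)
  have sp: "space L1 = space (PiM J (\<lambda>_. borel))" "space L2 = space (PiM J (\<lambda>_. borel))"
    using s[THEN sets_eq_imp_space_eq] by auto
  \<comment> \<open>the cut-off measures agree, being finite with equal distribution functions\<close>
  have d: "density L1 (indicator (E (\<lambda>_. e))) = density L2 (indicator (E (\<lambda>_. e)))" if e: "0 < e" for e
  proof (rule finite_measure_eqI_orthants[OF J])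
    have res: "emeasure (density L (indicator (E (\<lambda>_. e)))) B = emeasure L (E (\<lambda>_. e) \<inter> B)"
      if "sets L = sets (PiM J (\<lambda>_. borel))" "B \<in> sets L" for L B
      using that E by (intro emeasure_restricted) auto
    have fin_d: "finite_measure (density L (indicator (E (\<lambda>_. e))))"
      if "sets L = sets (PiM J (\<lambda>_. borel))" "emeasure L (E (\<lambda>_. e)) < \<top>" for L
    proof (rule finite_measureI)
      have "emeasure L (E (\<lambda>_. e) \<inter> space L) \<le> emeasure L (E (\<lambda>_. e))"
        using that E by (intro emeasure_mono) auto
      then show "emeasure (density L (indicator (E (\<lambda>_. e)))) (space (density L (indicator (E (\<lambda>_. e))))) \<noteq> \<infinity>"
        using that res[of L "space L"] sets.top[of L] by (auto simp: top_unique)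
    qed
    show "finite_measure (density L1 (indicator (E (\<lambda>_. e))))" "finite_measure (density L2 (indicator (E (\<lambda>_. e))))"
      using fin[of "\<lambda>_. e"] eq[of "\<lambda>_. e"] e fin_d[OF s(1)] fin_d[OF s(2)] by (simp_all add: E_def)
    have ae: "AE x in density L (indicator (E (\<lambda>_. e))). 0 \<le> x j"
      if [measurable_cong]: "sets L = sets (PiM J (\<lambda>_. borel))"
        and n: "AE x in L. (\<exists>j\<in>J. 0 < x j) \<longrightarrow> (\<forall>j\<in>J. 0 \<le> x j)" and j: "j \<in> J" for L j
    proof -
      have "AE x in L. 0 < (indicator (E (\<lambda>_. e)) x :: ennreal) \<longrightarrow> 0 \<le> x j"
        using n by eventually_elim (use e j in \<open>auto simp: indicator_def E_def split: if_splits intro: less_trans\<close>)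
      then show ?thesis by (subst AE_density) auto
    qed
    show "AE x in density L1 (indicator (E (\<lambda>_. e))). 0 \<le> x j" "AE x in density L2 (indicator (E (\<lambda>_. e))). 0 \<le> x j"
      if "j \<in> J" for j using ae s n1 n2 that by auto
    fix a :: "'k \<Rightarrow> real" assume a: "\<And>j. j \<in> J \<Longrightarrow> 0 < a j"
    \<comment> \<open>a coordinate exceeds \<open>b\<close> iff it exceeds \<open>e\<close> or exceeds \<open>a\<close>\<close>
    define b where "b j = min (a j) e" for j
    have b: "0 < b j" if "j \<in> J" for j using a[OF that] e by (simp add: b_def)
    have sub: "E a \<subseteq> E b" unfolding E_def b_def by (auto simp: min_less_iff_disj)
    have set: "E (\<lambda>_. e) \<inter> {x \<in> space (PiM J (\<lambda>_. borel)). \<forall>j\<in>J. x j \<le> a j} = E b - E a"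
      unfolding E_def b_def by (auto simp: min_less_iff_disj not_less not_le)
    have O: "{x \<in> space (PiM J (\<lambda>_. borel)). \<forall>j\<in>J. x j \<le> a j} \<in> sets (PiM J (\<lambda>_. borel))"
      using J by measurable
    have "emeasure L1 (E b - E a) = emeasure L1 (E b) - emeasure L1 (E a)"
      using fin[of a, OF a] sub E s by (intro emeasure_Diff) (auto simp: E_def)
    also have "\<dots> = emeasure L2 (E b) - emeasure L2 (E a)" using eq[of a, OF a] eq[of b, OF b] by (simp add: E_def)
    also have "\<dots> = emeasure L2 (E b - E a)"
      using fin[of a, OF a] eq[of a, OF a] sub E s by (intro emeasure_Diff[symmetric]) (auto simp: E_def)
    finally show "emeasure (density L1 (indicator (E (\<lambda>_. e)))) {x \<in> space (density L1 (indicator (E (\<lambda>_. e)))). \<forall>j\<in>J. x j \<le> a j}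
      = emeasure (density L2 (indicator (E (\<lambda>_. e)))) {x \<in> space (density L2 (indicator (E (\<lambda>_. e)))). \<forall>j\<in>J. x j \<le> a j}"
      using O s by (simp add: res sp set)
  qed (use s in auto)
  \<comment> \<open>the cut-off level decreases to \<open>0\<close> along \<open>1 / (n + 1)\<close>\<close>
  have m: "emeasure L1 (E (\<lambda>_. 0) \<inter> B) = emeasure L2 (E (\<lambda>_. 0) \<inter> B)" if B: "B \<in> sets (PiM J (\<lambda>_. borel))" for B
  proof -
    define U where "U n = E (\<lambda>_. inverse (real (Suc n))) \<inter> B" for n
    have U: "range U \<subseteq> sets (PiM J (\<lambda>_. borel))" unfolding U_def using B by auto
    have inc: "incseq U"
    proof (rule incseq_SucI)
      fix n
      have "inverse (real (Suc (Suc n))) \<le> inverse (real (Suc n))" by (intro le_imp_inverse_le) auto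
      then show "U n \<subseteq> U (Suc n)" unfolding U_def using E_mono by blast
    qed
    have un: "(\<Union>n. U n) = E (\<lambda>_. 0) \<inter> B"
    proof
      have "E (\<lambda>_. inverse (real (Suc n))) \<subseteq> E (\<lambda>_. 0)" for n by (rule E_mono) simp
      then show "(\<Union>n. U n) \<subseteq> E (\<lambda>_. 0) \<inter> B" unfolding U_def by blast
      show "E (\<lambda>_. 0) \<inter> B \<subseteq> (\<Union>n. U n)"
      proof
        fix x assume x: "x \<in> E (\<lambda>_. 0) \<inter> B"
        then obtain j where j: "j \<in> J" "0 < x j" by (auto simp: E_def)
        obtain n where n: "inverse (real (Suc n)) < x j" using reals_Archimedean[OF j(2)] by blast
        have "x \<in> U n" using x j(1) n unfolding U_def E_def by blast
        then show "x \<in> (\<Union>n. U n)" by blast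
      qed
    qed
    have "emeasure L1 (U n) = emeasure L2 (U n)" for n
      using d[of "inverse (real (Suc n))"] B s E
        emeasure_restricted[of "E (\<lambda>_. inverse (real (Suc n)))" L1 B]
        emeasure_restricted[of "E (\<lambda>_. inverse (real (Suc n)))" L2 B] by (simp add: U_def)
    then show ?thesis
      using SUP_emeasure_incseq[of U L1] SUP_emeasure_incseq[of U L2] U inc s by (simp add: un)
  qed
  have dd: "density L1 (indicator (E (\<lambda>_. 0))) = density L2 (indicator (E (\<lambda>_. 0)))"
    by (rule measure_eqI) (use s E m in \<open>auto simp: emeasure_restricted\<close>)
  have "(\<integral>\<^sup>+x. indicator {x. \<exists>j\<in>J. 0 < x j} x * h x \<partial>L) = (\<integral>\<^sup>+x. h x \<partial>density L (indicator (E (\<lambda>_. 0))))"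
    if [measurable_cong]: "sets L = sets (PiM J (\<lambda>_. borel))" for L
  proof -
    have "(\<integral>\<^sup>+x. h x \<partial>density L (indicator (E (\<lambda>_. 0)))) = (\<integral>\<^sup>+x. indicator (E (\<lambda>_. 0)) x * h x \<partial>L)"
      by (rule nn_integral_density) auto
    also have "\<dots> = (\<integral>\<^sup>+x. indicator {x. \<exists>j\<in>J. 0 < x j} x * h x \<partial>L)"
      using sets_eq_imp_space_eq[OF that] by (intro nn_integral_cong) (auto simp: E_def indicator_def)
    finally show ?thesis by simp
  qed
  then show ?thesis using s dd by simp
qed

text \<open>
  Both families of integrals are multiples of integrals against the Levy measures, so each of the two
  reconstruction lemmas gives one implication.
\<close>

theorem sum_norms_eq_iff_max_norms_eq:
  fixes f :: "'k \<Rightarrow> 's \<Rightarrow> real" and g :: "'k \<Rightarrow> 't \<Rightarrow> real"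
  assumes \<alpha>: "0 < \<alpha>" "\<alpha> < 2" and J: "finite J" "J \<noteq> {}"
    and f: "\<And>j. j \<in> J \<Longrightarrow> f j \<in> borel_measurable M" "\<And>j. j \<in> J \<Longrightarrow> AE s in M. 0 \<le> f j s"
    and g: "\<And>j. j \<in> J \<Longrightarrow> g j \<in> borel_measurable N" "\<And>j. j \<in> J \<Longrightarrow> AE s in N. 0 \<le> g j s"
    and fin_sum: "\<And>a. (\<integral>\<^sup>+s. ennreal (\<bar>\<Sum>j\<in>J. a j * f j s\<bar> powr \<alpha>) \<partial>M) < \<top>"
    and fin_max: "\<And>a. (\<And>j. j \<in> J \<Longrightarrow> 0 < a j) \<Longrightarrow> (\<integral>\<^sup>+s. ennreal ((MAX j\<in>J. f j s / a j) powr \<alpha>) \<partial>M) < \<top>"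
  shows "(\<forall>a. (\<integral>\<^sup>+s. ennreal (\<bar>\<Sum>j\<in>J. a j * f j s\<bar> powr \<alpha>) \<partial>M)
            = (\<integral>\<^sup>+s. ennreal (\<bar>\<Sum>j\<in>J. a j * g j s\<bar> powr \<alpha>) \<partial>N))
     \<longleftrightarrow> (\<forall>a. (\<forall>j\<in>J. 0 < a j) \<longrightarrow> (\<integral>\<^sup>+s. ennreal ((MAX j\<in>J. f j s / a j) powr \<alpha>) \<partial>M)
            = (\<integral>\<^sup>+s. ennreal ((MAX j\<in>J. g j s / a j) powr \<alpha>) \<partial>N))"
    (is "(\<forall>a. ?F a = ?G a) \<longleftrightarrow> (\<forall>a. _ \<longrightarrow> ?F' a = ?G' a)")
proof
  assume eq: "\<forall>a. ?F a = ?G a"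
  show "\<forall>a. (\<forall>j\<in>J. 0 < a j) \<longrightarrow> ?F' a = ?G' a"
  proof (intro allI impI)
    fix a :: "'k \<Rightarrow> real" assume a: "\<forall>j\<in>J. 0 < a j"
    let ?E = "{x \<in> space (PiM J (\<lambda>_. borel)). \<exists>j\<in>J. a j < x j}"
    have "emeasure (levy_measure \<alpha> M J f) ?E = emeasure (levy_measure \<alpha> N J g) ?E"
    proof (rule levy_measure_eq_off_origin[OF \<alpha> J(1) f(1) g(1) fin_sum])
      show "?E \<in> sets (PiM J (\<lambda>_. borel))" using J by measurable
      show "\<exists>j\<in>J. x j \<noteq> 0" if "x \<in> ?E" for x using that a by force
    qed (use eq in auto)
    moreover have "emeasure (levy_measure \<alpha> M J f) ?E = tail_const \<alpha> * ?F' a"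
      by (rule levy_measure_exceedance[OF J f]) (use a in auto)
    moreover have "emeasure (levy_measure \<alpha> N J g) ?E = tail_const \<alpha> * ?G' a"
      by (rule levy_measure_exceedance[OF J g]) (use a in auto)
    ultimately have "tail_const \<alpha> * ?F' a = tail_const \<alpha> * ?G' a" by (simp only:)
    then show "?F' a = ?G' a"
      using tail_const_finite[OF \<alpha>(1)] tail_const_nonzero by (auto simp: ennreal_mult_cancel_left)
  qed
next
  assume eq: "\<forall>a. (\<forall>j\<in>J. 0 < a j) \<longrightarrow> ?F' a = ?G' a"
  show "\<forall>a. ?F a = ?G a"
  proof
    fix a :: "'k \<Rightarrow> real"
    have "(\<integral>\<^sup>+x. indicator {x. \<exists>j\<in>J. 0 < x j} x * ennreal (1 - cos (\<Sum>j\<in>J. a j * x j)) \<partial>levy_measure \<alpha> M J f)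
        = (\<integral>\<^sup>+x. indicator {x. \<exists>j\<in>J. 0 < x j} x * ennreal (1 - cos (\<Sum>j\<in>J. a j * x j)) \<partial>levy_measure \<alpha> N J g)"
    proof (rule measure_eq_on_positive_part[OF J(1)])
      fix b :: "'k \<Rightarrow> real" assume b: "\<And>j. j \<in> J \<Longrightarrow> 0 < b j"
      have xf: "emeasure (levy_measure \<alpha> M J f) {x \<in> space (PiM J (\<lambda>_. borel)). \<exists>j\<in>J. b j < x j} = tail_const \<alpha> * ?F' b"
        by (rule levy_measure_exceedance[OF J f]) (use b in auto)
      have xg: "emeasure (levy_measure \<alpha> N J g) {x \<in> space (PiM J (\<lambda>_. borel)). \<exists>j\<in>J. b j < x j} = tail_const \<alpha> * ?G' b"
        by (rule levy_measure_exceedance[OF J g]) (use b in auto)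
      show "emeasure (levy_measure \<alpha> M J f) {x \<in> space (PiM J (\<lambda>_. borel)). \<exists>j\<in>J. b j < x j} < \<top>"
        unfolding xf using tail_const_finite[OF \<alpha>(1)] fin_max[of b, OF b] by (simp only: ennreal_mult_less_top) blast
      have "?F' b = ?G' b" using eq b by blast
      then show "emeasure (levy_measure \<alpha> M J f) {x \<in> space (PiM J (\<lambda>_. borel)). \<exists>j\<in>J. b j < x j}
          = emeasure (levy_measure \<alpha> N J g) {x \<in> space (PiM J (\<lambda>_. borel)). \<exists>j\<in>J. b j < x j}"
        unfolding xf xg by (simp only:)
    qed (use J f g in \<open>auto intro!: levy_measure_nonneg\<close>)
    then have "half_cos_const \<alpha> * ?F a = half_cos_const \<alpha> * ?G a"
      by (simp only: levy_measure_cos_positive_part[of J f M, OF J(1) f] levy_measure_cos_positive_part[of J g N, OF J(1) g])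
    then show "?F a = ?G a"
      using half_cos_const_finite[OF \<alpha>] half_cos_const_nonzero by (auto simp: ennreal_mult_cancel_left)
  qed
qed

section \<open>Sum norms and max norms\<close>

text \<open>
  Bounding every term by the largest one works for all positive exponents, also for \<open>\<alpha> < 1\<close>, where
  convexity is not available.
\<close>

lemma abs_sum_powr_le:
  fixes c :: "'k \<Rightarrow> real"
  assumes J: "finite J" and \<alpha>: "0 < \<alpha>"
  shows "\<bar>\<Sum>j\<in>J. c j\<bar> powr \<alpha> \<le> real (card J) powr \<alpha> * (\<Sum>j\<in>J. \<bar>c j\<bar> powr \<alpha>)"
proof (cases "J = {}")
  case False
  define m where "m = Max ((\<lambda>j. \<bar>c j\<bar>) ` J)"
  have "m \<in> (\<lambda>j. \<bar>c j\<bar>) ` J" unfolding m_def using J False by (intro Max_in) auto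
  then obtain k where k: "k \<in> J" "m = \<bar>c k\<bar>" by auto
  have le: "\<bar>c j\<bar> \<le> m" if "j \<in> J" for j unfolding m_def using that J by simp
  have "\<bar>\<Sum>j\<in>J. c j\<bar> \<le> (\<Sum>j\<in>J. \<bar>c j\<bar>)" by (rule sum_abs)
  also have "\<dots> \<le> real (card J) * m" using le by (rule sum_bounded_above)
  finally have "\<bar>\<Sum>j\<in>J. c j\<bar> powr \<alpha> \<le> (real (card J) * m) powr \<alpha>"
    using \<alpha> by (intro powr_mono2) auto
  also have "\<dots> = real (card J) powr \<alpha> * \<bar>c k\<bar> powr \<alpha>" unfolding k(2) by (rule powr_mult)
  also have "\<dots> \<le> real (card J) powr \<alpha> * (\<Sum>j\<in>J. \<bar>c j\<bar> powr \<alpha>)"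
    using J k by (intro mult_left_mono member_le_sum) auto
  finally show ?thesis .
qed simp

lemma integrable_abs_sum_powr:
  assumes J: "finite J" and \<alpha>: "0 < \<alpha>" and f: "\<And>j. j \<in> J \<Longrightarrow> f j \<in> L_space \<alpha> M"
  shows "integrable M (\<lambda>x. \<bar>\<Sum>j\<in>J. a j * f j x\<bar> powr \<alpha>)"
proof (rule Bochner_Integration.integrable_bound)
  have [measurable]: "f j \<in> borel_measurable M" if "j \<in> J" for j
    using f[OF that] by (simp add: L_space_def)
  have I: "integrable M (\<lambda>x. \<bar>f j x\<bar> powr \<alpha>)" if "j \<in> J" for j
    using f[OF that] by (simp add: L_space_def)
  show "integrable M (\<lambda>x. real (card J) powr \<alpha> * (\<Sum>j\<in>J. \<bar>a j\<bar> powr \<alpha> * \<bar>f j x\<bar> powr \<alpha>))"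
    using I by auto
  show "(\<lambda>x. \<bar>\<Sum>j\<in>J. a j * f j x\<bar> powr \<alpha>) \<in> borel_measurable M" by measurable
  have "\<bar>\<Sum>j\<in>J. a j * f j x\<bar> powr \<alpha> \<le> real (card J) powr \<alpha> * (\<Sum>j\<in>J. \<bar>a j\<bar> powr \<alpha> * \<bar>f j x\<bar> powr \<alpha>)" for x
    using abs_sum_powr_le[OF J \<alpha>, of "\<lambda>j. a j * f j x"] by (simp add: abs_mult powr_mult)
  then show "AE x in M. norm (\<bar>\<Sum>j\<in>J. a j * f j x\<bar> powr \<alpha>)
      \<le> norm (real (card J) powr \<alpha> * (\<Sum>j\<in>J. \<bar>a j\<bar> powr \<alpha> * \<bar>f j x\<bar> powr \<alpha>))"
    by (auto intro!: AE_I2 order_trans[OF _ abs_ge_self])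
qed

lemma integrable_Max_powr:
  assumes J: "finite J" "J \<noteq> {}" and f: "\<And>j. j \<in> J \<Longrightarrow> f j \<in> L_plus \<alpha> M" and a: "\<And>j. j \<in> J \<Longrightarrow> 0 < a j"
  shows "integrable M (\<lambda>x. (MAX j\<in>J. f j x / a j) powr \<alpha>)"
proof (rule Bochner_Integration.integrable_bound)
  have [measurable]: "f j \<in> borel_measurable M" if "j \<in> J" for j
    using f[OF that] by (simp add: L_plus_def L_space_def)
  have I: "integrable M (\<lambda>x. \<bar>f j x\<bar> powr \<alpha>)" if "j \<in> J" for j
    using f[OF that] by (simp add: L_plus_def L_space_def)
  have nn: "AE x in M. \<forall>j\<in>J. 0 \<le> f j x"
    using J f by (simp add: AE_finite_all L_plus_def)
  show "integrable M (\<lambda>x. \<Sum>j\<in>J. \<bar>f j x\<bar> powr \<alpha> / a j powr \<alpha>)"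
    using I by auto
  show "(\<lambda>x. (MAX j\<in>J. f j x / a j) powr \<alpha>) \<in> borel_measurable M"
    using J by measurable
  show "AE x in M. norm ((MAX j\<in>J. f j x / a j) powr \<alpha>) \<le> norm (\<Sum>j\<in>J. \<bar>f j x\<bar> powr \<alpha> / a j powr \<alpha>)"
    using nn
  proof eventually_elim
    fix x assume pos: "\<forall>j\<in>J. 0 \<le> f j x"
    have "(MAX j\<in>J. f j x / a j) \<in> (\<lambda>j. f j x / a j) ` J" using J by (intro Max_in) auto
    then obtain k where k: "k \<in> J" "(MAX j\<in>J. f j x / a j) = f k x / a k" by auto
    have "(f k x / a k) powr \<alpha> = \<bar>f k x\<bar> powr \<alpha> / a k powr \<alpha>"
      using k pos a[OF k(1)] by (simp add: powr_divide)
    also have "\<dots> \<le> (\<Sum>j\<in>J. \<bar>f j x\<bar> powr \<alpha> / a j powr \<alpha>)"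
      using J k by (intro member_le_sum) auto
    finally show "norm ((MAX j\<in>J. f j x / a j) powr \<alpha>) \<le> norm (\<Sum>j\<in>J. \<bar>f j x\<bar> powr \<alpha> / a j powr \<alpha>)"
      unfolding k(2) by (auto intro: order_trans[OF _ abs_ge_self])
  qed
qed

lemma integral_eq_iff_nn_integral_eq:
  fixes u :: "'s \<Rightarrow> real" and v :: "'t \<Rightarrow> real"
  assumes "integrable M u" "integrable N v" "\<And>x. 0 \<le> u x" "\<And>x. 0 \<le> v x"
  shows "(\<integral>x. u x \<partial>M) = (\<integral>x. v x \<partial>N) \<longleftrightarrow> (\<integral>\<^sup>+x. ennreal (u x) \<partial>M) = (\<integral>\<^sup>+x. ennreal (v x) \<partial>N)"
  using assms by (simp add: nn_integral_eq_integral integral_nonneg_AE)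

text \<open>
  The identities between spectral functions that equality of the finite-dimensional distributions
  amounts to: \<open>sum_norms_agree\<close> for stable integrals and \<open>max_norms_agree\<close> for extremal integrals. The
  indices \<open>t j\<close> may repeat, as they may in the specification of the integrals.
\<close>

definition sum_norms_agree ::
  "real \<Rightarrow> 'i set \<Rightarrow> 's measure \<Rightarrow> ('i \<Rightarrow> 's \<Rightarrow> real) \<Rightarrow> 't measure \<Rightarrow> ('i \<Rightarrow> 't \<Rightarrow> real) \<Rightarrow> bool" where
  "sum_norms_agree \<alpha> T M f N g \<longleftrightarrow>
     (\<forall>n::nat. \<forall>t. 0 < n \<and> (\<forall>j<n. t j \<in> T) \<longrightarrow>
       (\<forall>a. (\<integral>x. \<bar>\<Sum>j<n. a j * f (t j) x\<bar> powr \<alpha> \<partial>M) = (\<integral>x. \<bar>\<Sum>j<n. a j * g (t j) x\<bar> powr \<alpha> \<partial>N)))"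

definition max_norms_agree ::
  "real \<Rightarrow> 'i set \<Rightarrow> 's measure \<Rightarrow> ('i \<Rightarrow> 's \<Rightarrow> real) \<Rightarrow> 't measure \<Rightarrow> ('i \<Rightarrow> 't \<Rightarrow> real) \<Rightarrow> bool" where
  "max_norms_agree \<alpha> T M f N g \<longleftrightarrow>
     (\<forall>n::nat. \<forall>t. 0 < n \<and> (\<forall>j<n. t j \<in> T) \<longrightarrow>
       (\<forall>a. (\<forall>j<n. 0 < a j) \<longrightarrow>
         (\<integral>x. (MAX j\<in>{..<n}. f (t j) x / a j) powr \<alpha> \<partial>M) = (\<integral>x. (MAX j\<in>{..<n}. g (t j) x / a j) powr \<alpha> \<partial>N)))"

lemma sum_norms_agree_iff_max_norms_agree:
  assumes \<alpha>: "0 < \<alpha>" "\<alpha> < 2" and f: "\<forall>t\<in>T. f t \<in> L_plus \<alpha> M" and g: "\<forall>t\<in>T. g t \<in> L_plus \<alpha> N"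
  shows "sum_norms_agree \<alpha> T M f N g \<longleftrightarrow> max_norms_agree \<alpha> T M f N g"
proof -
  have pointwise: "(\<forall>a. (\<integral>x. \<bar>\<Sum>j<n. a j * f (t j) x\<bar> powr \<alpha> \<partial>M) = (\<integral>x. \<bar>\<Sum>j<n. a j * g (t j) x\<bar> powr \<alpha> \<partial>N))
    \<longleftrightarrow> (\<forall>a. (\<forall>j<n. 0 < a j) \<longrightarrow>
         (\<integral>x. (MAX j\<in>{..<n}. f (t j) x / a j) powr \<alpha> \<partial>M) = (\<integral>x. (MAX j\<in>{..<n}. g (t j) x / a j) powr \<alpha> \<partial>N))"
    if n: "0 < n" and t: "\<forall>j<n. t j \<in> T" for n :: nat and t
  proof -
    have J: "finite {..<n}" "{..<n} \<noteq> {}" using n by auto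
    have fp: "f (t j) \<in> L_plus \<alpha> M" and gp: "g (t j) \<in> L_plus \<alpha> N" if "j \<in> {..<n}" for j
      using f g t that by auto
    have fs: "f (t j) \<in> L_space \<alpha> M" "f (t j) \<in> borel_measurable M" "AE x in M. 0 \<le> f (t j) x"
      and gs: "g (t j) \<in> L_space \<alpha> N" "g (t j) \<in> borel_measurable N" "AE x in N. 0 \<le> g (t j) x"
      if "j \<in> {..<n}" for j
      using fp[OF that] gp[OF that] by (auto simp: L_plus_def L_space_def)
    have S: "(\<integral>x. \<bar>\<Sum>j<n. a j * f (t j) x\<bar> powr \<alpha> \<partial>M) = (\<integral>x. \<bar>\<Sum>j<n. a j * g (t j) x\<bar> powr \<alpha> \<partial>N)
      \<longleftrightarrow> (\<integral>\<^sup>+x. ennreal (\<bar>\<Sum>j<n. a j * f (t j) x\<bar> powr \<alpha>) \<partial>M) = (\<integral>\<^sup>+x. ennreal (\<bar>\<Sum>j<n. a j * g (t j) x\<bar> powr \<alpha>) \<partial>N)" for a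
      by (rule integral_eq_iff_nn_integral_eq)
         (auto intro!: integrable_abs_sum_powr[OF J(1) \<alpha>(1)] fs gs)
    have Mx: "(\<integral>x. (MAX j\<in>{..<n}. f (t j) x / a j) powr \<alpha> \<partial>M) = (\<integral>x. (MAX j\<in>{..<n}. g (t j) x / a j) powr \<alpha> \<partial>N)
      \<longleftrightarrow> (\<integral>\<^sup>+x. ennreal ((MAX j\<in>{..<n}. f (t j) x / a j) powr \<alpha>) \<partial>M)
        = (\<integral>\<^sup>+x. ennreal ((MAX j\<in>{..<n}. g (t j) x / a j) powr \<alpha>) \<partial>N)"
      if "\<forall>j\<in>{..<n}. 0 < a j" for a
      using that by (intro integral_eq_iff_nn_integral_eq integrable_Max_powr[OF J] fp gp) auto
    have fin_sum: "(\<integral>\<^sup>+x. ennreal (\<bar>\<Sum>j<n. a j * f (t j) x\<bar> powr \<alpha>) \<partial>M) < \<top>" for a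
      using integrable_abs_sum_powr[OF J(1) \<alpha>(1) fs(1), where a=a]
      by (simp add: integrable_iff_bounded)
    have fin_max: "(\<integral>\<^sup>+x. ennreal ((MAX j\<in>{..<n}. f (t j) x / a j) powr \<alpha>) \<partial>M) < \<top>"
      if "\<And>j. j \<in> {..<n} \<Longrightarrow> 0 < a j" for a
      using integrable_Max_powr[OF J fp that] by (simp add: integrable_iff_bounded)
    note iff = sum_norms_eq_iff_max_norms_eq[OF \<alpha> J, of "\<lambda>j. f (t j)" M "\<lambda>j. g (t j)" N,
        OF fs(2,3) gs(2,3) fin_sum fin_max]
    have all: "(\<forall>j<n. 0 < a j) \<longleftrightarrow> (\<forall>j\<in>{..<n}. 0 < a j)" for a :: "nat \<Rightarrow> real" by auto
    have "(\<forall>a. (\<integral>x. \<bar>\<Sum>j<n. a j * f (t j) x\<bar> powr \<alpha> \<partial>M) = (\<integral>x. \<bar>\<Sum>j<n. a j * g (t j) x\<bar> powr \<alpha> \<partial>N))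
      \<longleftrightarrow> (\<forall>a. (\<forall>j\<in>{..<n}. 0 < a j) \<longrightarrow> (\<integral>\<^sup>+x. ennreal ((MAX j\<in>{..<n}. f (t j) x / a j) powr \<alpha>) \<partial>M)
        = (\<integral>\<^sup>+x. ennreal ((MAX j\<in>{..<n}. g (t j) x / a j) powr \<alpha>) \<partial>N))"
      unfolding S by (rule iff)
    then show ?thesis unfolding all using Mx by (auto simp del: lessThan_iff)
  qed
  show ?thesis
    unfolding sum_norms_agree_def max_norms_agree_def
    by (rule iff_allI, rule iff_allI, rule imp_cong[OF refl], elim conjE, rule pointwise)
qed

section \<open>Finite-dimensional distributions of the integrals\<close>

lemma measurable_restrict_process:
  assumes "\<And>t. t \<in> J \<Longrightarrow> X t \<in> borel_measurable P"
  shows "(\<lambda>\<omega>. \<lambda>t\<in>J. X t \<omega>) \<in> measurable P (PiM J (\<lambda>_. borel :: real measure))"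
  using assms by (intro measurable_restrict) auto

text \<open>
  The characteristic function of a finite-dimensional distribution is the exponential of minus a sum
  norm, so the norms can be read off from it, and by uniqueness they determine the distribution.
\<close>

lemma stable_integrals_fdd_eq_iff:
  assumes X1: "stable_integrals \<alpha> T M f P1 X1" and X2: "stable_integrals \<alpha> T N g P2 X2"
  shows "fdd_eq T P1 X1 P2 X2 \<longleftrightarrow> sum_norms_agree \<alpha> T M f N g"
proof
  have meas: "X1 t \<in> borel_measurable P1" "X2 t \<in> borel_measurable P2" if "t \<in> T" for t
    using X1 X2 that by (auto simp: stable_integrals_def SaS_process_def)
  have ch1: "(\<integral>\<omega>. exp (- (\<i> * complex_of_real (\<Sum>j<n. a j * X1 (t j) \<omega>))) \<partial>P1) =
        complex_of_real (exp (- (\<integral>x. \<bar>\<Sum>j<n. a j * f (t j) x\<bar> powr \<alpha> \<partial>M)))"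
    if "0 < n" "\<forall>j<n. t j \<in> T" for n :: nat and t a using X1 that by (auto simp: stable_integrals_def)
  have ch2: "(\<integral>\<omega>. exp (- (\<i> * complex_of_real (\<Sum>j<n. a j * X2 (t j) \<omega>))) \<partial>P2) =
        complex_of_real (exp (- (\<integral>x. \<bar>\<Sum>j<n. a j * g (t j) x\<bar> powr \<alpha> \<partial>N)))"
    if "0 < n" "\<forall>j<n. t j \<in> T" for n :: nat and t a using X2 that by (auto simp: stable_integrals_def)
  {
    assume fdd: "fdd_eq T P1 X1 P2 X2"
    show "sum_norms_agree \<alpha> T M f N g"
      unfolding sum_norms_agree_def
    proof (intro allI impI, elim conjE)
      fix n :: nat and t :: "nat \<Rightarrow> 'a" and a :: "nat \<Rightarrow> real"
      assume n: "0 < n" and t: "\<forall>j<n. t j \<in> T"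
      define J where "J = t ` {..<n}"
      have J: "finite J" "J \<subseteq> T" using t by (auto simp: J_def)
      define e where "e x = exp (- (\<i> * complex_of_real (\<Sum>j<n. a j * x (t j))))" for x :: "'a \<Rightarrow> real"
      have [measurable]: "(\<lambda>x. x (t j)) \<in> borel_measurable (PiM J (\<lambda>_. borel :: real measure))" if "j \<in> {..<n}" for j
        using that by (intro measurable_component_singleton) (auto simp: J_def)
      have e: "e \<in> borel_measurable (PiM J (\<lambda>_. borel))" unfolding e_def by measurable
      have int: "(\<integral>x. e x \<partial>distr P (PiM J (\<lambda>_. borel)) (\<lambda>\<omega>. \<lambda>t\<in>J. X t \<omega>))
          = (\<integral>\<omega>. exp (- (\<i> * complex_of_real (\<Sum>j<n. a j * X (t j) \<omega>))) \<partial>P)"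
        if "\<And>t. t \<in> T \<Longrightarrow> X t \<in> borel_measurable P" for P :: "'z measure" and X
      proof -
        have "(\<integral>x. e x \<partial>distr P (PiM J (\<lambda>_. borel)) (\<lambda>\<omega>. \<lambda>t\<in>J. X t \<omega>)) = (\<integral>\<omega>. e (\<lambda>t\<in>J. X t \<omega>) \<partial>P)"
          using that J by (intro integral_distr measurable_restrict_process e) auto
        also have "\<dots> = (\<integral>\<omega>. exp (- (\<i> * complex_of_real (\<Sum>j<n. a j * X (t j) \<omega>))) \<partial>P)"
          by (simp add: e_def J_def cong: sum.cong_simp)
        finally show ?thesis .
      qed
      have "distr P1 (PiM J (\<lambda>_. borel)) (\<lambda>\<omega>. \<lambda>t\<in>J. X1 t \<omega>) = distr P2 (PiM J (\<lambda>_. borel)) (\<lambda>\<omega>. \<lambda>t\<in>J. X2 t \<omega>)"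
        using fdd J by (simp add: fdd_eq_def)
      then have "(\<integral>\<omega>. exp (- (\<i> * complex_of_real (\<Sum>j<n. a j * X1 (t j) \<omega>))) \<partial>P1)
          = (\<integral>\<omega>. exp (- (\<i> * complex_of_real (\<Sum>j<n. a j * X2 (t j) \<omega>))) \<partial>P2)"
        using int[of X1 P1] int[of X2 P2] meas by simp
      then show "(\<integral>x. \<bar>\<Sum>j<n. a j * f (t j) x\<bar> powr \<alpha> \<partial>M) = (\<integral>x. \<bar>\<Sum>j<n. a j * g (t j) x\<bar> powr \<alpha> \<partial>N)"
        unfolding ch1[OF n t] ch2[OF n t] by (simp only: of_real_eq_iff exp_inj_iff neg_equal_iff_equal)
    qed
  }
  {
    assume agree: "sum_norms_agree \<alpha> T M f N g"
    show "fdd_eq T P1 X1 P2 X2"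
      unfolding fdd_eq_def
    proof (intro allI impI, elim conjE)
      fix J assume J: "finite J" "J \<subseteq> T"
      have P: "prob_space P1" "prob_space P2"
        using X1 X2 by (auto simp: stable_integrals_def SaS_process_def)
      have mr: "(\<lambda>\<omega>. \<lambda>t\<in>J. X1 t \<omega>) \<in> measurable P1 (PiM J (\<lambda>_. borel))"
        "(\<lambda>\<omega>. \<lambda>t\<in>J. X2 t \<omega>) \<in> measurable P2 (PiM J (\<lambda>_. borel))"
        using meas J by (auto intro!: measurable_restrict_process)
      have char_eq: "(\<integral>\<omega>. exp (- (\<i> * complex_of_real (\<Sum>j\<in>J. a j * X1 j \<omega>))) \<partial>P1)
          = (\<integral>\<omega>. exp (- (\<i> * complex_of_real (\<Sum>j\<in>J. a j * X2 j \<omega>))) \<partial>P2)" for a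
      proof (cases "J = {}")
        case True
        then show ?thesis using P by (simp add: prob_space.prob_space)
      next
        case False
        obtain t where t: "bij_betw t {..<card J} J"
          using ex_bij_betw_nat_finite[OF J(1)] by (auto simp: lessThan_atLeast0)
        have n: "0 < card J" using J False by (simp add: card_gt_0_iff)
        have tT: "\<forall>j<card J. t j \<in> T" using t J by (auto simp: bij_betw_def)
        have re: "(\<Sum>j\<in>J. a j * x j) = (\<Sum>k<card J. a (t k) * x (t k))" for x
          using sum.reindex_bij_betw[OF t, of "\<lambda>j. a j * x j"] by simp
        have "(\<integral>x. \<bar>\<Sum>j<card J. a (t j) * f (t j) x\<bar> powr \<alpha> \<partial>M) = (\<integral>x. \<bar>\<Sum>j<card J. a (t j) * g (t j) x\<bar> powr \<alpha> \<partial>N)"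
          using agree[unfolded sum_norms_agree_def, rule_format, of "card J" t "\<lambda>k. a (t k)"] n tT by blast
        then show ?thesis
          using ch1[OF n tT, of "\<lambda>k. a (t k)"] ch2[OF n tT, of "\<lambda>k. a (t k)"]
          unfolding re[of "\<lambda>j. X1 j _"] re[of "\<lambda>j. X2 j _"] by simp
      qed
      have cos: "(\<integral>x. cos ((\<Sum>j\<in>J. a j * x j) + c) \<partial>distr P (PiM J (\<lambda>_. borel)) (\<lambda>\<omega>. \<lambda>t\<in>J. X t \<omega>))
          = Re (exp (- (\<i> * complex_of_real c)) * (\<integral>\<omega>. exp (- (\<i> * complex_of_real (\<Sum>j\<in>J. a j * X j \<omega>))) \<partial>P))"
        if P: "prob_space P" and X: "\<And>t. t \<in> T \<Longrightarrow> X t \<in> borel_measurable P" for P :: "'z measure" and X a c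
      proof -
        interpret prob_space P by fact
        have [measurable]: "X t \<in> borel_measurable P" if "t \<in> J" for t using X J that by auto
        have I: "integrable P (\<lambda>\<omega>. exp (- (\<i> * complex_of_real c)) * exp (- (\<i> * complex_of_real (\<Sum>j\<in>J. a j * X j \<omega>))))"
          by (rule integrable_const_bound[where B=1]) (auto simp: norm_mult)
        have "(\<integral>x. cos ((\<Sum>j\<in>J. a j * x j) + c) \<partial>distr P (PiM J (\<lambda>_. borel)) (\<lambda>\<omega>. \<lambda>t\<in>J. X t \<omega>))
          = (\<integral>\<omega>. cos ((\<Sum>j\<in>J. a j * (\<lambda>t\<in>J. X t \<omega>) j) + c) \<partial>P)"
          by (rule integral_distr[OF measurable_restrict_process]) (use X J in auto)
        also have "\<dots> = (\<integral>\<omega>. cos ((\<Sum>j\<in>J. a j * X j \<omega>) + c) \<partial>P)"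
          by (simp cong: sum.cong_simp)
        also have "\<dots> = (\<integral>\<omega>. Re (exp (- (\<i> * complex_of_real c)) * exp (- (\<i> * complex_of_real (\<Sum>j\<in>J. a j * X j \<omega>)))) \<partial>P)"
          by (simp add: Re_exp Im_exp cos_add mult.commute)
        also have "\<dots> = Re (\<integral>\<omega>. exp (- (\<i> * complex_of_real c)) * exp (- (\<i> * complex_of_real (\<Sum>j\<in>J. a j * X j \<omega>))) \<partial>P)"
          by (rule integral_Re[OF I])
        finally show ?thesis by simp
      qed
      show "distr P1 (PiM J (\<lambda>_. borel)) (\<lambda>\<omega>. \<lambda>t\<in>J. X1 t \<omega>) = distr P2 (PiM J (\<lambda>_. borel)) (\<lambda>\<omega>. \<lambda>t\<in>J. X2 t \<omega>)"
      proof (rule finite_measure_eqI_cos[OF J(1)])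
        show "finite_measure (distr P1 (PiM J (\<lambda>_. borel)) (\<lambda>\<omega>. \<lambda>t\<in>J. X1 t \<omega>))"
          "finite_measure (distr P2 (PiM J (\<lambda>_. borel)) (\<lambda>\<omega>. \<lambda>t\<in>J. X2 t \<omega>))"
          using P mr by (auto intro!: prob_space.finite_measure prob_space.prob_space_distr)
      qed (simp_all only: sets_distr cos[OF P(1) meas(1)] cos[OF P(2) meas(2)] char_eq)
    qed
  }
qed

text \<open>
  Needed because the distribution function of extremal integrals is specified at positive levels only.
\<close>

lemma Frechet_process_nonneg:
  assumes "Frechet_process \<alpha> T P Y" "t \<in> T"
  shows "AE \<omega> in P. 0 \<le> Y t \<omega>"
proof -
  have "Frechet_variable \<alpha> P (\<lambda>\<omega>. MAX j\<in>{..<1::nat}. 1 * Y t \<omega>)"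
    using assms(1)[unfolded Frechet_process_def, THEN conjunct2, THEN conjunct2, rule_format,
        of 1 "\<lambda>_. t" "\<lambda>_. 1"] assms(2) by simp
  then show ?thesis by (simp add: Frechet_variable_def lessThan_Suc)
qed

text \<open>
  The counterpart of \<open>stable_integrals_fdd_eq_iff\<close>, with joint distribution functions at positive
  levels in place of characteristic functions.
\<close>

lemma extremal_integrals_fdd_eq_iff:
  assumes Y1: "extremal_integrals \<alpha> T M f P1 Y1" and Y2: "extremal_integrals \<alpha> T N g P2 Y2"
  shows "fdd_eq T P1 Y1 P2 Y2 \<longleftrightarrow> max_norms_agree \<alpha> T M f N g"
proof
  have meas: "Y1 t \<in> borel_measurable P1" "Y2 t \<in> borel_measurable P2" if "t \<in> T" for t
    using Y1 Y2 that by (auto simp: extremal_integrals_def Frechet_process_def)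
  have df1: "\<P>(\<omega> in P1. \<forall>j<n. Y1 (t j) \<omega> \<le> a j) = exp (- (\<integral>x. (MAX j\<in>{..<n}. f (t j) x / a j) powr \<alpha> \<partial>M))"
    if "0 < n" "\<forall>j<n. t j \<in> T" "\<forall>j<n. 0 < a j" for n :: nat and t a
    using Y1 that by (auto simp: extremal_integrals_def)
  have df2: "\<P>(\<omega> in P2. \<forall>j<n. Y2 (t j) \<omega> \<le> a j) = exp (- (\<integral>x. (MAX j\<in>{..<n}. g (t j) x / a j) powr \<alpha> \<partial>N))"
    if "0 < n" "\<forall>j<n. t j \<in> T" "\<forall>j<n. 0 < a j" for n :: nat and t a
    using Y2 that by (auto simp: extremal_integrals_def)
  {
    assume fdd: "fdd_eq T P1 Y1 P2 Y2"
    show "max_norms_agree \<alpha> T M f N g"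
      unfolding max_norms_agree_def
    proof (intro allI impI, elim conjE)
      fix n :: nat and t :: "nat \<Rightarrow> 'a" and a :: "nat \<Rightarrow> real"
      assume n: "0 < n" and t: "\<forall>j<n. t j \<in> T" and a: "\<forall>j<n. 0 < a j"
      define J where "J = t ` {..<n}"
      have J: "finite J" "J \<subseteq> T" using t by (auto simp: J_def)
      define A where "A = {x \<in> space (PiM J (\<lambda>_. borel :: real measure)). \<forall>j\<in>{..<n}. x (t j) \<le> a j}"
      have [measurable]: "(\<lambda>x. x (t j)) \<in> borel_measurable (PiM J (\<lambda>_. borel :: real measure))" if "j \<in> {..<n}" for j
        using that by (intro measurable_component_singleton) (auto simp: J_def)
      have A: "A \<in> sets (PiM J (\<lambda>_. borel))" unfolding A_def by measurable
      have m: "measure (distr P (PiM J (\<lambda>_. borel)) (\<lambda>\<omega>. \<lambda>t\<in>J. Y t \<omega>)) A = \<P>(\<omega> in P. \<forall>j<n. Y (t j) \<omega> \<le> a j)"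
        if "\<And>t. t \<in> T \<Longrightarrow> Y t \<in> borel_measurable P" for P :: "'z measure" and Y
      proof -
        have "(\<lambda>\<omega>. \<lambda>t\<in>J. Y t \<omega>) -` A \<inter> space P = {\<omega>\<in>space P. \<forall>j<n. Y (t j) \<omega> \<le> a j}"
          by (auto simp: A_def J_def space_PiM)
        then show ?thesis
          using that J by (subst measure_distr[OF measurable_restrict_process A]) auto
      qed
      have "distr P1 (PiM J (\<lambda>_. borel)) (\<lambda>\<omega>. \<lambda>t\<in>J. Y1 t \<omega>) = distr P2 (PiM J (\<lambda>_. borel)) (\<lambda>\<omega>. \<lambda>t\<in>J. Y2 t \<omega>)"
        using fdd J by (simp add: fdd_eq_def)
      then have "\<P>(\<omega> in P1. \<forall>j<n. Y1 (t j) \<omega> \<le> a j) = \<P>(\<omega> in P2. \<forall>j<n. Y2 (t j) \<omega> \<le> a j)"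
        using m[of Y1 P1] m[of Y2 P2] meas by simp
      then show "(\<integral>x. (MAX j\<in>{..<n}. f (t j) x / a j) powr \<alpha> \<partial>M) = (\<integral>x. (MAX j\<in>{..<n}. g (t j) x / a j) powr \<alpha> \<partial>N)"
        unfolding df1[OF n t a] df2[OF n t a] by (simp only: exp_inj_iff neg_equal_iff_equal)
    qed
  }
  {
    assume agree: "max_norms_agree \<alpha> T M f N g"
    show "fdd_eq T P1 Y1 P2 Y2"
      unfolding fdd_eq_def
    proof (intro allI impI, elim conjE)
      fix J assume J: "finite J" "J \<subseteq> T"
      have P: "prob_space P1" "prob_space P2"
        using Y1 Y2 by (auto simp: extremal_integrals_def Frechet_process_def)
      have nn: "AE \<omega> in P1. 0 \<le> Y1 t \<omega>" "AE \<omega> in P2. 0 \<le> Y2 t \<omega>" if "t \<in> T" for t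
        using Frechet_process_nonneg that Y1 Y2 by (auto simp: extremal_integrals_def)
      have mr: "(\<lambda>\<omega>. \<lambda>t\<in>J. Y1 t \<omega>) \<in> measurable P1 (PiM J (\<lambda>_. borel))"
        "(\<lambda>\<omega>. \<lambda>t\<in>J. Y2 t \<omega>) \<in> measurable P2 (PiM J (\<lambda>_. borel))"
        using meas J by (auto intro!: measurable_restrict_process)
      have prob_eq: "\<P>(\<omega> in P1. \<forall>j\<in>J. Y1 j \<omega> \<le> a j) = \<P>(\<omega> in P2. \<forall>j\<in>J. Y2 j \<omega> \<le> a j)"
        if a: "\<And>j. j \<in> J \<Longrightarrow> 0 < a j" for a
      proof (cases "J = {}")
        case True
        then show ?thesis using P by (simp add: prob_space.prob_space)
      next
        case False
        obtain t where t: "bij_betw t {..<card J} J"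
          using ex_bij_betw_nat_finite[OF J(1)] by (auto simp: lessThan_atLeast0)
        have n: "0 < card J" using J False by (simp add: card_gt_0_iff)
        have tJ: "t ` {..<card J} = J" using t by (simp add: bij_betw_def)
        then have tT: "\<forall>j<card J. t j \<in> T" and ta: "\<forall>j<card J. 0 < a (t j)" using J a by auto
        have re: "(\<forall>j\<in>J. x j \<le> a j) \<longleftrightarrow> (\<forall>k<card J. x (t k) \<le> a (t k))" for x
        proof -
          have "(\<forall>j\<in>t ` {..<card J}. x j \<le> a j) \<longleftrightarrow> (\<forall>k<card J. x (t k) \<le> a (t k))" by auto
          then show ?thesis unfolding tJ .
        qed
        have "(\<integral>x. (MAX j\<in>{..<card J}. f (t j) x / a (t j)) powr \<alpha> \<partial>M) = (\<integral>x. (MAX j\<in>{..<card J}. g (t j) x / a (t j)) powr \<alpha> \<partial>N)"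
          using agree[unfolded max_norms_agree_def, THEN spec[of _ "card J"], THEN spec[of _ t], THEN mp,
              THEN spec[of _ "\<lambda>k. a (t k)"]] n tT ta by blast
        then show ?thesis
          using df1[OF n tT ta] df2[OF n tT ta] unfolding re by (simp only:)
      qed
      have em: "emeasure (distr P (PiM J (\<lambda>_. borel)) (\<lambda>\<omega>. \<lambda>t\<in>J. Y t \<omega>))
           {x \<in> space (distr P (PiM J (\<lambda>_. borel)) (\<lambda>\<omega>. \<lambda>t\<in>J. Y t \<omega>)). \<forall>j\<in>J. x j \<le> a j}
          = ennreal (\<P>(\<omega> in P. \<forall>j\<in>J. Y j \<omega> \<le> a j))"
        if P: "prob_space P" and Y: "\<And>t. t \<in> T \<Longrightarrow> Y t \<in> borel_measurable P" for P :: "'z measure" and Y and a :: "'a \<Rightarrow> real"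
      proof -
        interpret prob_space P by fact
        have A: "{x \<in> space (PiM J (\<lambda>_. borel :: real measure)). \<forall>j\<in>J. x j \<le> a j} \<in> sets (PiM J (\<lambda>_. borel))"
          using J(1) by measurable
        have "(\<lambda>\<omega>. \<lambda>t\<in>J. Y t \<omega>) -` {x \<in> space (PiM J (\<lambda>_. borel :: real measure)). \<forall>j\<in>J. x j \<le> a j} \<inter> space P
            = {\<omega>\<in>space P. \<forall>j\<in>J. Y j \<omega> \<le> a j}"
          by (auto simp: space_PiM)
        then show ?thesis
          using Y J by (simp add: emeasure_distr[OF measurable_restrict_process A] subset_eq emeasure_eq_measure)
      qed
      show "distr P1 (PiM J (\<lambda>_. borel)) (\<lambda>\<omega>. \<lambda>t\<in>J. Y1 t \<omega>) = distr P2 (PiM J (\<lambda>_. borel)) (\<lambda>\<omega>. \<lambda>t\<in>J. Y2 t \<omega>)"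
      proof (rule finite_measure_eqI_orthants[OF J(1)])
        show "finite_measure (distr P1 (PiM J (\<lambda>_. borel)) (\<lambda>\<omega>. \<lambda>t\<in>J. Y1 t \<omega>))"
          "finite_measure (distr P2 (PiM J (\<lambda>_. borel)) (\<lambda>\<omega>. \<lambda>t\<in>J. Y2 t \<omega>))"
          using P mr by (auto intro!: prob_space.finite_measure prob_space.prob_space_distr)
        show "AE x in distr P1 (PiM J (\<lambda>_. borel)) (\<lambda>\<omega>. \<lambda>t\<in>J. Y1 t \<omega>). 0 \<le> x j" if "j \<in> J" for j
          using nn(1)[of j] that J by (subst AE_distr_iff[OF mr(1)]) auto
        show "AE x in distr P2 (PiM J (\<lambda>_. borel)) (\<lambda>\<omega>. \<lambda>t\<in>J. Y2 t \<omega>). 0 \<le> x j" if "j \<in> J" for j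
          using nn(2)[of j] that J by (subst AE_distr_iff[OF mr(2)]) auto
        fix a :: "'a \<Rightarrow> real" assume "\<And>j. j \<in> J \<Longrightarrow> 0 < a j"
        then show "emeasure (distr P1 (PiM J (\<lambda>_. borel)) (\<lambda>\<omega>. \<lambda>t\<in>J. Y1 t \<omega>))
           {x \<in> space (distr P1 (PiM J (\<lambda>_. borel)) (\<lambda>\<omega>. \<lambda>t\<in>J. Y1 t \<omega>)). \<forall>j\<in>J. x j \<le> a j}
          = emeasure (distr P2 (PiM J (\<lambda>_. borel)) (\<lambda>\<omega>. \<lambda>t\<in>J. Y2 t \<omega>))
           {x \<in> space (distr P2 (PiM J (\<lambda>_. borel)) (\<lambda>\<omega>. \<lambda>t\<in>J. Y2 t \<omega>)). \<forall>j\<in>J. x j \<le> a j}"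
          by (simp only: em[OF P(1) meas(1)] em[OF P(2) meas(2)] prob_eq)
      qed auto
    qed
  }
qed

section \<open>Spectral representations\<close>

lemma fdd_eq_sym: "fdd_eq T P X Q Y \<Longrightarrow> fdd_eq T Q Y P X"
  by (simp add: fdd_eq_def)

lemma fdd_eq_trans: "fdd_eq T P X Q Y \<Longrightarrow> fdd_eq T Q Y R Z \<Longrightarrow> fdd_eq T P X R Z"
  by (simp add: fdd_eq_def)

text \<open>
  The integrals of \<open>f\<close> that realise \<open>X\<close> are also integrals of \<open>g\<close> once the norms agree, because
  integrals are specified through their finite-dimensional distributions. No new process has to be
  constructed.
\<close>

lemma SaS_spectral_rep_iff:
  fixes P :: "'a measure" and X :: "'i \<Rightarrow> 'a \<Rightarrow> real"
  assumes rep: "SaS_spectral_rep \<alpha> T M f P X" and g: "\<forall>t\<in>T. g t \<in> L_space \<alpha> N"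
  shows "SaS_spectral_rep \<alpha> T N g P X \<longleftrightarrow> sum_norms_agree \<alpha> T M f N g"
proof -
  obtain R Z where Z: "stable_integrals \<alpha> T M f (R :: ('i \<Rightarrow> real) measure) Z" and XZ: "fdd_eq T P X R Z"
    using rep by (auto simp: SaS_spectral_rep_def)
  show ?thesis
  proof
    assume "SaS_spectral_rep \<alpha> T N g P X"
    then obtain R' Z' where Z': "stable_integrals \<alpha> T N g (R' :: ('i \<Rightarrow> real) measure) Z'" and "fdd_eq T P X R' Z'"
      by (auto simp: SaS_spectral_rep_def)
    then have "fdd_eq T R Z R' Z'" using XZ fdd_eq_sym fdd_eq_trans by blast
    then show "sum_norms_agree \<alpha> T M f N g" using stable_integrals_fdd_eq_iff[OF Z Z'] by simp
  next
    assume agree: "sum_norms_agree \<alpha> T M f N g"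
    have "stable_integrals \<alpha> T N g R Z"
      using Z g agree unfolding stable_integrals_def sum_norms_agree_def by simp
    then show "SaS_spectral_rep \<alpha> T N g P X"
      using rep XZ unfolding SaS_spectral_rep_def by blast
  qed
qed

lemma Frechet_spectral_rep_iff:
  fixes Q :: "'a measure" and Y :: "'i \<Rightarrow> 'a \<Rightarrow> real"
  assumes rep: "Frechet_spectral_rep \<alpha> T M f Q Y" and g: "\<forall>t\<in>T. g t \<in> L_plus \<alpha> N"
  shows "Frechet_spectral_rep \<alpha> T N g Q Y \<longleftrightarrow> max_norms_agree \<alpha> T M f N g"
proof -
  obtain R Z where Z: "extremal_integrals \<alpha> T M f (R :: ('i \<Rightarrow> real) measure) Z" and YZ: "fdd_eq T Q Y R Z"
    using rep by (auto simp: Frechet_spectral_rep_def)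
  show ?thesis
  proof
    assume "Frechet_spectral_rep \<alpha> T N g Q Y"
    then obtain R' Z' where Z': "extremal_integrals \<alpha> T N g (R' :: ('i \<Rightarrow> real) measure) Z'" and "fdd_eq T Q Y R' Z'"
      by (auto simp: Frechet_spectral_rep_def)
    then have "fdd_eq T R Z R' Z'" using YZ fdd_eq_sym fdd_eq_trans by blast
    then show "max_norms_agree \<alpha> T M f N g" using extremal_integrals_fdd_eq_iff[OF Z Z'] by simp
  next
    assume agree: "max_norms_agree \<alpha> T M f N g"
    have "extremal_integrals \<alpha> T N g R Z"
      using Z g agree unfolding extremal_integrals_def max_norms_agree_def by simp
    then show "Frechet_spectral_rep \<alpha> T N g Q Y"
      using rep YZ unfolding Frechet_spectral_rep_def by blast
  qed
qed

theorem theorem4p1: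
  fixes \<alpha> :: real and T :: "'i set"
    and M1 :: "'s1 measure" and M2 :: "'s2 measure"
    and f1 :: "'i \<Rightarrow> 's1 \<Rightarrow> real" and f2 :: "'i \<Rightarrow> 's2 \<Rightarrow> real"
    and P :: "'a measure" and X :: "'i \<Rightarrow> 'a \<Rightarrow> real"
    and Q :: "'b measure" and Y :: "'i \<Rightarrow> 'b \<Rightarrow> real"
  assumes "0 < \<alpha>" and "\<alpha> < 2"
    and "sigma_finite_measure M1" and "sigma_finite_measure M2"
    and "SaS_process \<alpha> T P X" and "Frechet_process \<alpha> T Q Y"
    and "associated_by \<alpha> T P X Q Y M1 f1"
    and "\<forall>t\<in>T. f2 t \<in> L_plus \<alpha> M2"
  shows "(SaS_spectral_rep \<alpha> T M2 f2 P X \<longleftrightarrow> Frechet_spectral_rep \<alpha> T M2 f2 Q Y) \<and>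
    (\<forall>(P1 :: 'c1 measure) X1 (P2 :: 'c2 measure) X2 (Q1 :: 'd1 measure) Y1 (Q2 :: 'd2 measure) Y2.
       stable_integrals \<alpha> T M1 f1 P1 X1 \<and> stable_integrals \<alpha> T M2 f2 P2 X2 \<and>
       extremal_integrals \<alpha> T M1 f1 Q1 Y1 \<and> extremal_integrals \<alpha> T M2 f2 Q2 Y2 \<longrightarrow>
       (fdd_eq T P1 X1 P2 X2 \<longleftrightarrow> fdd_eq T Q1 Y1 Q2 Y2))"
proof (intro conjI allI impI)
  note \<alpha> = assms(1,2)
  have f1: "\<forall>t\<in>T. f1 t \<in> L_plus \<alpha> M1" and X: "SaS_spectral_rep \<alpha> T M1 f1 P X"
    and Y: "Frechet_spectral_rep \<alpha> T M1 f1 Q Y"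
    using assms(7) by (auto simp: associated_by_def)
  have f2: "\<forall>t\<in>T. f2 t \<in> L_space \<alpha> M2" using assms(8) by (simp add: L_plus_def)
  note iff = sum_norms_agree_iff_max_norms_agree[OF \<alpha> f1 assms(8)]
  show "SaS_spectral_rep \<alpha> T M2 f2 P X \<longleftrightarrow> Frechet_spectral_rep \<alpha> T M2 f2 Q Y"
    using SaS_spectral_rep_iff[OF X f2] Frechet_spectral_rep_iff[OF Y assms(8)] iff by simp
  fix P1 :: "'c1 measure" and X1 and P2 :: "'c2 measure" and X2
    and Q1 :: "'d1 measure" and Y1 and Q2 :: "'d2 measure" and Y2
  assume "stable_integrals \<alpha> T M1 f1 P1 X1 \<and> stable_integrals \<alpha> T M2 f2 P2 X2 \<and>
       extremal_integrals \<alpha> T M1 f1 Q1 Y1 \<and> extremal_integrals \<alpha> T M2 f2 Q2 Y2"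
  then show "fdd_eq T P1 X1 P2 X2 \<longleftrightarrow> fdd_eq T Q1 Y1 Q2 Y2"
    using stable_integrals_fdd_eq_iff extremal_integrals_fdd_eq_iff iff by blast
qed

end
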